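(* Let $d\in\{2,3\}$, $\alpha>0$, $\widehat C_{\rm exc}>0$, $\theta\in\{1,\tfrac12\}$ and periods $L_1,\dots,L_d>0$ be fixed, and let the magnetization be a constant unit vector, $\bm m_i=\bm m\in\mathbb R^3$, $|\bm m|=1$, at every grid node. Let $H_T,S_T$ be the tangent-reduced matrices defined in the context. Then the tangent basis can be chosen spatially constant, $H_T$ and $S_T$ commute, and for every $\lambda>0$ the matrix $$T_{\lambda,T}=(\lambda I+S_T)^{-1}(\lambda I-H_T)(\lambda I+H_T)^{-1}(\lambda I-S_T)$$ is normal with spectral radius $$\rho(T_{\lambda,T})=\max_{\mu\in\sigma(H_T)}\left|\frac{\lambda-\mu}{\lambda+\mu}\right|.$$ With $h=\min_\ell L_\ell/N_\ell$ and $\beta_h=\alpha+\theta k\widehat C_{\rm exc}\max_{\bm\xi\in\mathcal F_N}|\bm\xi|^2$, $$\min_{\lambda>0}\rho(T_{\lambda,T})=\frac{\sqrt{\beta_h/\alpha}-1}{\sqrt{\beta_h/\alpha}+1},$$ and this quantity tends to $1$ along any family of grids and time steps $k>0$ with $h\to0$ and $k/h^2\to\infty$. Hence no scalar shift $\lambda$, even if chosen optimally for each $(k,h)$, yields a contraction factor $\rho(T_{\lambda,T})$ uniformly below one along such a family.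
   Context: Grid: a uniform periodic Cartesian grid on $\prod_{\ell=1}^d(0,L_\ell)$ with $N_\ell$ points in direction $\ell$, $N_g=\prod_\ell N_\ell$. The discrete Fourier wave vectors $\bm\xi\in\mathcal F_N$ have components $\xi_\ell=2\pi k_\ell/L_\ell$ with integers $|k_\ell|\le N_\ell/2$, where in each direction $k_\ell$ runs through the usual centred set of $N_\ell$ representatives modulo $N_\ell$ (containing $0$ and one of absolute value $\lfloor N_\ell/2\rfloor$). $-\Delta_N$ multiplies the discrete Fourier coefficient at $\bm\xi$ by $|\bm\xi|^2$. $H\in\mathbb R^{3N_g\times3N_g}$ is the matrix of $\alpha I+\theta k\widehat C_{\rm exc}(-\Delta_N)$ acting componentwise on $\mathbb R^3$-valued grid functions (nodal values as unknowns). $S$ is block diagonal with $3\times3$ blocks $\Lambda_i$, $\Lambda_i\bm a=\bm m_i\times\bm a$. $B\in\mathbb R^{N_g\times3N_g}$ is block diagonal with blocks $\bm m_i^T$. $Z\in\mathbb R^{3N_g\times2N_g}$ has orthonormal columns spanning $\ker B$; $H_T=Z^THZ$, $S_T=Z^TSZ$. "Spatially constant tangent basis" means that $Z$ is block diagonal with the same $3\times2$ block (orthonormal basis of $\bm m^\perp$) at every node. *)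

theory Defs
  imports "HOL-Analysis.Cross3" "HOL-Library.FuncSet" "Jordan_Normal_Form.Spectral_Radius" "Jordan_Normal_Form.Matrix_Kernel"
begin

text \<open>
  Directions are numbered \<open>0, \<dots>, d - 1\<close>, and \<open>N l\<close>, \<open>L l\<close> are the number of points and the
  period in direction \<open>l\<close>.  Grid functions are functions on multi-indices.  Vectors of nodal
  values and matrices are the variable-dimension ones of \<open>Jordan_Normal_Form\<close>, because the
  dimension changes along a family of grids.
\<close>

definition num_nodes :: "nat \<Rightarrow> (nat \<Rightarrow> nat) \<Rightarrow> nat" where
  "num_nodes d N = (\<Prod>l<d. N l)"

definition grid :: "nat \<Rightarrow> (nat \<Rightarrow> nat) \<Rightarrow> (nat \<Rightarrow> nat) set" where
  "grid d N = (\<Pi>\<^sub>E l\<in>{..<d}. {..<N l})"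

text \<open>Lexicographic numbering of the nodes: the mixed-radix digits of \<open>i < num_nodes d N\<close>.\<close>

definition node :: "nat \<Rightarrow> (nat \<Rightarrow> nat) \<Rightarrow> nat \<Rightarrow> (nat \<Rightarrow> nat)" where
  "node d N i = (\<lambda>l\<in>{..<d}. i div (\<Prod>l'<l. N l') mod N l)"

definition mesh_width :: "nat \<Rightarrow> (nat \<Rightarrow> real) \<Rightarrow> (nat \<Rightarrow> nat) \<Rightarrow> real" where
  "mesh_width d L N = Min ((\<lambda>l. L l / real (N l)) ` {..<d})"

text \<open>
  For even \<open>n\<close> there are two centred sets of representatives modulo \<open>n\<close> (containing \<open>n / 2\<close> or
  \<open>- n / 2\<close>); the predicate admits both.
\<close>

definition centred_reps :: "nat \<Rightarrow> int set \<Rightarrow> bool" where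
  "centred_reps n K \<longleftrightarrow>
     card K = n \<and> inj_on (\<lambda>k. k mod int n) K \<and> (\<forall>k\<in>K. 2 * \<bar>k\<bar> \<le> int n)"

text \<open>
  \<open>K n\<close> is the chosen centred set of representatives modulo \<open>n\<close>.  A wave vector \<open>\<xi>\<close> is
  represented by its integer components \<open>\<kappa> l\<close>, with \<open>\<xi>\<^sub>l = 2 \<pi> \<kappa>\<^sub>l / L\<^sub>l\<close>.
\<close>

definition wave_numbers :: "nat \<Rightarrow> (nat \<Rightarrow> int set) \<Rightarrow> (nat \<Rightarrow> nat) \<Rightarrow> (nat \<Rightarrow> int) set" where
  "wave_numbers d K N = (\<Pi>\<^sub>E l\<in>{..<d}. K (N l))"

definition wave_vec :: "(nat \<Rightarrow> real) \<Rightarrow> (nat \<Rightarrow> int) \<Rightarrow> nat \<Rightarrow> real" where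
  "wave_vec L \<kappa> l = 2 * pi * of_int (\<kappa> l) / L l"

definition wave_norm2 :: "nat \<Rightarrow> (nat \<Rightarrow> real) \<Rightarrow> (nat \<Rightarrow> int) \<Rightarrow> real" where
  "wave_norm2 d L \<kappa> = (\<Sum>l<d. (wave_vec L \<kappa> l)\<^sup>2)"

text \<open>The phase \<open>\<xi> \<bullet> x\<close> at the grid point \<open>x\<close> with multi-index \<open>j\<close>, that is \<open>x\<^sub>l = j\<^sub>l L\<^sub>l / N\<^sub>l\<close>.\<close>

definition phase ::
  "nat \<Rightarrow> (nat \<Rightarrow> real) \<Rightarrow> (nat \<Rightarrow> nat) \<Rightarrow> (nat \<Rightarrow> int) \<Rightarrow> (nat \<Rightarrow> nat) \<Rightarrow> real" where
  "phase d L N \<kappa> j = (\<Sum>l<d. wave_vec L \<kappa> l * (real (j l) * (L l / real (N l))))"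

definition dft ::
  "nat \<Rightarrow> (nat \<Rightarrow> real) \<Rightarrow> (nat \<Rightarrow> nat) \<Rightarrow> ((nat \<Rightarrow> nat) \<Rightarrow> complex) \<Rightarrow> (nat \<Rightarrow> int) \<Rightarrow> complex" where
  "dft d L N u \<kappa> =
     (\<Sum>j\<in>grid d N. u j * cis (- phase d L N \<kappa> j)) / of_nat (num_nodes d N)"

definition neg_laplacian ::
  "nat \<Rightarrow> (nat \<Rightarrow> real) \<Rightarrow> (nat \<Rightarrow> int set) \<Rightarrow> (nat \<Rightarrow> nat)
     \<Rightarrow> ((nat \<Rightarrow> nat) \<Rightarrow> complex) \<Rightarrow> (nat \<Rightarrow> nat) \<Rightarrow> complex" where
  "neg_laplacian d L K N u j =
     (\<Sum>\<kappa>\<in>wave_numbers d K N.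
        of_real (wave_norm2 d L \<kappa>) * dft d L N u \<kappa> * cis (phase d L N \<kappa> j))"

text \<open>
  Taking real parts loses nothing, since the operator maps real grid functions to real ones
  (lemma \<open>neg_laplacian_real\<close> below).
\<close>

definition neg_laplacian_mat ::
  "nat \<Rightarrow> (nat \<Rightarrow> real) \<Rightarrow> (nat \<Rightarrow> int set) \<Rightarrow> (nat \<Rightarrow> nat) \<Rightarrow> real mat" where
  "neg_laplacian_mat d L K N =
     Matrix.mat (num_nodes d N) (num_nodes d N)
       (\<lambda>(r, s). Re (neg_laplacian d L K N (\<lambda>x. if x = node d N s then 1 else 0) (node d N r)))"

text \<open>
  The unknown of component \<open>p < 3\<close> at node \<open>i\<close> has number \<open>3 * i + p\<close>.
\<close>

definition componentwise :: "real mat \<Rightarrow> real mat" where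
  "componentwise A = Matrix.mat (3 * dim_row A) (3 * dim_col A)
     (\<lambda>(r, s). if r mod 3 = s mod 3 then A $$ (r div 3, s div 3) else 0)"

definition H_mat ::
  "nat \<Rightarrow> (nat \<Rightarrow> real) \<Rightarrow> (nat \<Rightarrow> int set) \<Rightarrow> real \<Rightarrow> real \<Rightarrow> real
     \<Rightarrow> (nat \<Rightarrow> nat) \<Rightarrow> real \<Rightarrow> real mat" where
  "H_mat d L K \<alpha> \<theta> C N k =
     componentwise (\<alpha> \<cdot>\<^sub>m 1\<^sub>m (num_nodes d N) + (\<theta> * k * C) \<cdot>\<^sub>m neg_laplacian_mat d L K N)"

definition vec_of_R3 :: "real^3 \<Rightarrow> real Matrix.vec" where
  "vec_of_R3 a = vec_of_list [vec_nth a 1, vec_nth a 2, vec_nth a 3]"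

definition cross_mat :: "real^3 \<Rightarrow> real mat" where
  "cross_mat m = mat_of_cols 3 (map (\<lambda>q. vec_of_R3 (cross3 m (axis q 1))) [1, 2, 3])"

text \<open>In \<open>S_mat\<close> and \<open>B_mat\<close>, \<open>ng\<close> is the number of nodes and \<open>m i\<close> the magnetization at node \<open>i\<close>.\<close>

definition S_mat :: "nat \<Rightarrow> (nat \<Rightarrow> real^3) \<Rightarrow> real mat" where
  "S_mat ng m = diag_block_mat (map (\<lambda>i. cross_mat (m i)) [0..<ng])"

definition B_mat :: "nat \<Rightarrow> (nat \<Rightarrow> real^3) \<Rightarrow> real mat" where
  "B_mat ng m = diag_block_mat (map (\<lambda>i. mat_of_rows 3 [vec_of_R3 (m i)]) [0..<ng])"

definition onb_columns :: "nat \<Rightarrow> nat \<Rightarrow> real Matrix.vec set \<Rightarrow> real mat \<Rightarrow> bool" where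
  "onb_columns n r V Z \<longleftrightarrow>
     Z \<in> carrier_mat n r \<and> Z\<^sup>T * Z = 1\<^sub>m r \<and> vec_space.col_space n Z = V"

definition tangent_basis :: "nat \<Rightarrow> (nat \<Rightarrow> real^3) \<Rightarrow> real mat \<Rightarrow> bool" where
  "tangent_basis ng m Z \<longleftrightarrow> onb_columns (3 * ng) (2 * ng) (mat_kernel (B_mat ng m)) Z"

definition spatially_constant_basis :: "nat \<Rightarrow> real^3 \<Rightarrow> real mat \<Rightarrow> bool" where
  "spatially_constant_basis ng m Z \<longleftrightarrow>
     (\<exists>W. onb_columns 3 2 (vec_of_R3 ` {a. m \<bullet> a = 0}) W \<and> Z = diag_block_mat (replicate ng W))"

definition tangent_reduce :: "real mat \<Rightarrow> real mat \<Rightarrow> real mat" where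
  "tangent_reduce Z A = Z\<^sup>T * A * Z"

text \<open>Meaningful only if the two matrices to be inverted are invertible.\<close>

definition T_mat :: "real mat \<Rightarrow> real mat \<Rightarrow> real \<Rightarrow> real mat" where
  "T_mat HT ST lam = (let I = 1\<^sub>m (dim_row HT) in
     the (mat_inverse (lam \<cdot>\<^sub>m I + ST)) * (lam \<cdot>\<^sub>m I - HT)
       * the (mat_inverse (lam \<cdot>\<^sub>m I + HT)) * (lam \<cdot>\<^sub>m I - ST))"

definition normal_mat :: "real mat \<Rightarrow> bool" where
  "normal_mat A \<longleftrightarrow> A * A\<^sup>T = A\<^sup>T * A"

abbreviation complex_mat :: "real mat \<Rightarrow> complex mat" where
  "complex_mat \<equiv> map_mat complex_of_real"

definition beta_h ::
  "nat \<Rightarrow> (nat \<Rightarrow> real) \<Rightarrow> (nat \<Rightarrow> int set) \<Rightarrow> real \<Rightarrow> real \<Rightarrow> real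
     \<Rightarrow> (nat \<Rightarrow> nat) \<Rightarrow> real \<Rightarrow> real" where
  "beta_h d L K \<alpha> \<theta> C N k =
     \<alpha> + \<theta> * k * C * Max (wave_norm2 d L ` wave_numbers d K N)"

lemma centred_reps_int: "centred_reps n {- int (n div 2) ..< int n - int (n div 2)}"
  unfolding centred_reps_def
proof (intro conjI ballI)
  show "inj_on (\<lambda>k. k mod int n) {- int (n div 2) ..< int n - int (n div 2)}"
  proof (rule inj_onI)
    fix x y
    assume x: "x \<in> {- int (n div 2) ..< int n - int (n div 2)}"
      and y: "y \<in> {- int (n div 2) ..< int n - int (n div 2)}"
      and eq: "x mod int n = y mod int n"
    from eq have "int n dvd x - y" by (simp add: mod_eq_dvd_iff)
    moreover have "\<bar>x - y\<bar> < int n" using x y by auto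
    ultimately show "x = y" using zdvd_imp_le[of "int n" "\<bar>x - y\<bar>"] by fastforce
  qed
qed auto

lemma ex_neg_rep:
  assumes "centred_reps n K" "0 < n" "k \<in> K"
  shows "\<exists>k'\<in>K. int n dvd k + k' \<and> \<bar>k'\<bar> = \<bar>k\<bar>"
proof -
  from assms have fin: "finite K" and c: "card K = n" and i: "inj_on (\<lambda>k. k mod int n) K"
    and b: "\<And>k. k \<in> K \<Longrightarrow> 2 * \<bar>k\<bar> \<le> int n"
    by (auto simp: centred_reps_def intro: card_ge_0_finite)
  have "(\<lambda>k. k mod int n) ` K = {0..<int n}"
    by (rule card_subset_eq) (use assms(2) in \<open>auto simp: card_image[OF i] c\<close>)
  moreover have "(- k) mod int n \<in> {0..<int n}" using assms(2) by simp
  ultimately have "(- k) mod int n \<in> (\<lambda>k. k mod int n) ` K" by (simp only:)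
  then obtain k' where k': "k' \<in> K" "k' mod int n = (- k) mod int n" by auto
  hence d: "int n dvd k + k'" by (simp add: mod_eq_dvd_iff add.commute)
  then obtain q where q: "k + k' = int n * q" by (auto elim: dvdE)
  have "\<bar>int n * q\<bar> \<le> int n" using b[OF assms(3)] b[OF k'(1)] q by linarith
  hence "\<bar>q\<bar> \<le> 1" using assms(2) by (simp add: abs_mult)
  hence "q = 0 \<or> q = 1 \<or> q = -1" by linarith
  hence "\<bar>k'\<bar> = \<bar>k\<bar>" using b[OF assms(3)] b[OF k'(1)] q by auto
  thus ?thesis using k' d by blast
qed

lemma neg_laplacian_real:
  assumes K: "\<And>n. 0 < n \<Longrightarrow> centred_reps n (K n)"
    and N: "\<And>l. l < d \<Longrightarrow> 0 < N l" and L: "\<And>l. l < d \<Longrightarrow> 0 < L l"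
    and u: "\<And>j. j \<in> grid d N \<Longrightarrow> u j \<in> \<real>" and j: "j \<in> grid d N"
  shows "neg_laplacian d L K N u j \<in> \<real>"
proof -
  define nu where "nu = (\<lambda>l k. SOME k'. k' \<in> K (N l) \<and> int (N l) dvd k + k' \<and> \<bar>k'\<bar> = \<bar>k\<bar>)"
  have nu: "nu l k \<in> K (N l) \<and> int (N l) dvd k + nu l k \<and> \<bar>nu l k\<bar> = \<bar>k\<bar>"
    if "l < d" "k \<in> K (N l)" for l k
    unfolding nu_def
    by (rule someI_ex) (use ex_neg_rep[OF K[OF N[OF that(1)]] N[OF that(1)] that(2)] in blast)
  have nunu: "nu l (nu l k) = k" if l: "l < d" and k: "k \<in> K (N l)" for l k
  proof -
    have 1: "nu l k \<in> K (N l)" "int (N l) dvd k + nu l k" using nu[OF l k] by auto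
    have 2: "nu l (nu l k) \<in> K (N l)" "int (N l) dvd nu l k + nu l (nu l k)"
      using nu[OF l 1(1)] by auto
    have "int (N l) dvd nu l (nu l k) - k" using dvd_diff[OF 2(2) 1(2)] by simp
    hence "nu l (nu l k) mod int (N l) = k mod int (N l)" by (simp add: mod_eq_dvd_iff)
    thus ?thesis using K[OF N[OF l]] 2(1) k unfolding centred_reps_def inj_on_def by blast
  qed
  define P where "P = (\<lambda>\<kappa>. \<lambda>l\<in>{..<d}. nu l (\<kappa> l))"
  have W: "\<kappa> l \<in> K (N l)" if "\<kappa> \<in> wave_numbers d K N" "l < d" for \<kappa> l
    using that by (auto simp: wave_numbers_def)
  have PF: "P \<kappa> \<in> wave_numbers d K N" if "\<kappa> \<in> wave_numbers d K N" for \<kappa>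
    using W[OF that] nu unfolding wave_numbers_def P_def by auto
  have PP: "P (P \<kappa>) = \<kappa>" if "\<kappa> \<in> wave_numbers d K N" for \<kappa>
  proof
    fix l show "P (P \<kappa>) l = \<kappa> l"
      using that W[OF that] nunu by (auto simp: P_def wave_numbers_def PiE_def extensional_def)
  qed
  have bij: "bij_betw P (wave_numbers d K N) (wave_numbers d K N)"
    by (rule bij_betw_byWitness[where f' = P]) (use PF PP in auto)
  have norm: "wave_norm2 d L (P \<kappa>) = wave_norm2 d L \<kappa>" if "\<kappa> \<in> wave_numbers d K N" for \<kappa>
    unfolding wave_norm2_def
  proof (rule sum.cong[OF refl])
    fix l assume "l \<in> {..<d}"
    hence "\<bar>P \<kappa> l\<bar> = \<bar>\<kappa> l\<bar>" using nu W[OF that] by (auto simp: P_def)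
    hence "(P \<kappa> l)\<^sup>2 = (\<kappa> l)\<^sup>2" by (metis power2_abs)
    hence "(of_int (P \<kappa> l) :: real)\<^sup>2 = (of_int (\<kappa> l))\<^sup>2" by (metis of_int_power)
    thus "(wave_vec L (P \<kappa>) l)\<^sup>2 = (wave_vec L \<kappa> l)\<^sup>2"
      by (simp add: wave_vec_def power_divide power_mult_distrib)
  qed
  have ph: "cis (phase d L N (P \<kappa>) x) = cis (- phase d L N \<kappa> x)"
    if k: "\<kappa> \<in> wave_numbers d K N" for \<kappa> x
  proof -
    have "\<exists>q. phase d L N (P \<kappa>) x + phase d L N \<kappa> x = 2 * pi * of_int q"
    proof -
      have "\<forall>l\<in>{..<d}. \<exists>q. \<kappa> l + P \<kappa> l = int (N l) * q"
        using nu W[OF k] by (auto simp: P_def dvd_def)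
      then obtain q where q: "\<And>l. l < d \<Longrightarrow> \<kappa> l + P \<kappa> l = int (N l) * q l" by (metis lessThan_iff)
      have "phase d L N (P \<kappa>) x + phase d L N \<kappa> x
          = (\<Sum>l<d. 2 * pi * of_int (q l * int (x l)))"
        unfolding phase_def sum.distrib[symmetric]
      proof (rule sum.cong[OF refl])
        fix l assume "l \<in> {..<d}"
        hence l: "l < d" by simp
        have "(of_int (\<kappa> l) + of_int (P \<kappa> l) :: real) = real (N l) * of_int (q l)"
          using arg_cong[OF q[OF l], of "of_int :: int \<Rightarrow> real"] by simp
        moreover have "wave_vec L (P \<kappa>) l * (real (x l) * (L l / real (N l)))
            + wave_vec L \<kappa> l * (real (x l) * (L l / real (N l)))
            = 2 * pi * (of_int (\<kappa> l) + of_int (P \<kappa> l)) * real (x l) / real (N l)"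
          using N[OF l] L[OF l] by (simp add: wave_vec_def field_simps)
        ultimately show "wave_vec L (P \<kappa>) l * (real (x l) * (L l / real (N l)))
            + wave_vec L \<kappa> l * (real (x l) * (L l / real (N l)))
            = 2 * pi * of_int (q l * int (x l))"
          using N[OF l] by simp
      qed
      also have "\<dots> = 2 * pi * of_int (\<Sum>l<d. q l * int (x l))"
        by (simp add: sum_distrib_left)
      finally show ?thesis by blast
    qed
    then obtain q where "phase d L N (P \<kappa>) x = 2 * pi * of_int q + (- phase d L N \<kappa> x)"
      by (metis add_diff_cancel_right' diff_conv_add_uminus)
    thus ?thesis by (simp only: cis_mult[symmetric] cis_multiple_2pi[OF Ints_of_int]) simp
  qed
  have cu: "cnj (u x) = u x" if "x \<in> grid d N" for x
    using u[OF that] by (simp add: Reals_cnj_iff)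
  have "cnj (neg_laplacian d L K N u j) = (\<Sum>\<kappa>\<in>wave_numbers d K N.
      of_real (wave_norm2 d L \<kappa>) * ((\<Sum>x\<in>grid d N. u x * cis (phase d L N \<kappa> x))
        / of_nat (num_nodes d N)) * cis (- phase d L N \<kappa> j))"
    by (simp add: neg_laplacian_def dft_def cu cis_cnj)
  also have "\<dots> = (\<Sum>\<kappa>\<in>wave_numbers d K N.
      of_real (wave_norm2 d L (P \<kappa>)) * ((\<Sum>x\<in>grid d N. u x * cis (- phase d L N (P \<kappa>) x))
        / of_nat (num_nodes d N)) * cis (phase d L N (P \<kappa>) j))"
  proof (rule sum.cong[OF refl])
    fix \<kappa> assume k: "\<kappa> \<in> wave_numbers d K N"
    have "cis (- phase d L N (P \<kappa>) x) = cis (phase d L N \<kappa> x)" for x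
      using arg_cong[OF ph[OF k, of x], of cnj] by (simp add: cis_cnj)
    thus "of_real (wave_norm2 d L \<kappa>) * ((\<Sum>x\<in>grid d N. u x * cis (phase d L N \<kappa> x))
        / of_nat (num_nodes d N)) * cis (- phase d L N \<kappa> j) =
      of_real (wave_norm2 d L (P \<kappa>)) * ((\<Sum>x\<in>grid d N. u x * cis (- phase d L N (P \<kappa>) x))
        / of_nat (num_nodes d N)) * cis (phase d L N (P \<kappa>) j)"
      using norm[OF k] ph[OF k] by simp
  qed
  also have "\<dots> = neg_laplacian d L K N u j"
    unfolding neg_laplacian_def dft_def by (rule sum.reindex_bij_betw[OF bij])
  finally show ?thesis by (simp add: Reals_cnj_iff)
qed

lemma bij_betw_node: "bij_betw (node d N) {..<num_nodes d N} (grid d N)"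
proof -
  have eq: "i = i'"
    if "\<And>l. l < e \<Longrightarrow> i div (\<Prod>l'<l. N l') mod N l = i' div (\<Prod>l'<l. N l') mod N l"
      "i < (\<Prod>l<e. N l)" "i' < (\<Prod>l<e. N l)" for e i i'
  proof -
    have "i mod (\<Prod>l<e'. N l) = i' mod (\<Prod>l<e'. N l)" if "e' \<le> e" for e'
      using that
    proof (induction e')
      case (Suc e')
      thus ?case using that(1) \<open>\<And>l. l < e \<Longrightarrow> i div (\<Prod>l'<l. N l') mod N l = _\<close>[of e']
        by (simp add: mod_mult2_eq)
    qed simp
    from this[of e] that show ?thesis by simp
  qed
  have inj: "inj_on (node d N) {..<num_nodes d N}"
  proof (rule inj_onI)
    fix i i' assume i: "i \<in> {..<num_nodes d N}" "i' \<in> {..<num_nodes d N}"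
      and e: "node d N i = node d N i'"
    have "\<And>l. l < d \<Longrightarrow> i div (\<Prod>l'<l. N l') mod N l = i' div (\<Prod>l'<l. N l') mod N l"
      using fun_cong[OF e] by (simp add: node_def) presburger
    thus "i = i'" by (rule eq[of d]) (use i in \<open>simp_all add: num_nodes_def\<close>)
  qed
  have pos: "0 < N l" if "i < num_nodes d N" "l < d" for i l
  proof (rule gr0I)
    assume "N l = 0"
    hence "num_nodes d N = 0" unfolding num_nodes_def using that(2) by (intro prod_zero) auto
    thus False using that(1) by simp
  qed
  have sub: "node d N ` {..<num_nodes d N} \<subseteq> grid d N"
    using pos by (auto simp: node_def grid_def split: if_splits)
  have "card (grid d N) = num_nodes d N"
    by (simp add: grid_def num_nodes_def card_PiE)
  moreover have "finite (grid d N)" by (auto simp: grid_def intro: finite_PiE)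
  ultimately have "node d N ` {..<num_nodes d N} = grid d N"
    by (intro card_subset_eq sub) (auto simp: card_image[OF inj])
  thus ?thesis using inj by (simp add: bij_betw_def)
qed

end

theory Submission
  imports Defs
begin

text \<open>
  Writing \<open>A \<otimes> X\<close> for Kronecker products, \<open>H = A \<otimes> 1\<close> and \<open>S = 1 \<otimes> \<Lambda>\<close>, and every tangent
  basis satisfies \<open>Z Z\<^sup>T = 1 \<otimes> p\<close> with \<open>p = 1 - m m\<^sup>T\<close>.  As \<open>p\<close> commutes with \<open>1\<close> and \<open>\<Lambda>\<close>, compression by \<open>Z\<close>
  is multiplicative on these products; hence \<open>H\<^sub>T\<close> and \<open>S\<^sub>T\<close> commute, \<open>S\<^sub>T\<close> is skew with
  \<open>S\<^sub>T\<^sup>2 = -1\<close>, and the compressed Fourier projections are joint spectral projections of \<open>H\<^sub>T\<close> that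
  commute with \<open>S\<^sub>T\<close>.  Splitting them further by the eigenvalues \<open>\<i>\<close>, \<open>-\<i>\<close> of \<open>S\<^sub>T\<close> gives the
  spectrum of \<open>T\<close>: its eigenvalues are unit multiples of \<open>(\<lambda> - \<mu>) / (\<lambda> + \<mu>)\<close>.  The maximum over
  \<open>\<mu> \<in> [\<alpha>, \<beta>]\<close> is attained at an end point and is smallest for \<open>\<lambda> = sqrt (\<alpha> \<beta>)\<close>.
\<close>

section \<open>Spectra from two-sided eigenprojections\<close>

text \<open>The basis \<open>Z\<close> is arbitrary, so the reduced matrices need have no block
  structure. Only the product of \<open>Z\<close> with its transpose is under control: |m| = 1 makes
  the rows of \<open>B\<close> orthonormal, which forces that product to be the same orthogonal
  projector for every basis. All algebra is therefore moved to the places where \<open>Z\<close>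
  meets its transpose. Different wave numbers may give equal eigenvalues, so spectra are indexed by
  wave numbers and not by eigenvalues: a family of eigenprojections without a common nonzero kernel
  vector suffices, and no multiplicities have to be collected. Normality comes without eigenvectors:
  \<open>T\<close> commutes with every matrix that commutes with both reduced matrices, and its own
  transpose is such a matrix because one of them is symmetric and the other skew. The shift sqrt
  (\<alpha> \<beta>) is the one where the ratios at the two end points coincide. The limit rests on
  max |xi|^2 \<ge> 1 / h^2 on fine grids, so that \<beta> / \<alpha> is at least of order k /
  h^2.\<close>

text \<open>
  Both sides are required so that each inclusion of \<open>spectrum_eq_eigenmat_values\<close> can be read off
  directly; the \<open>P x\<close> there need neither be idempotent nor nonzero.
\<close>

definition eigenmat :: "'a::field mat \<Rightarrow> 'a mat \<Rightarrow> 'a \<Rightarrow> bool" where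
  "eigenmat A P a \<longleftrightarrow> A * P = a \<cdot>\<^sub>m P \<and> P * A = a \<cdot>\<^sub>m P"

lemma eigenmat_one: "P \<in> carrier_mat n n \<Longrightarrow> eigenmat (1\<^sub>m n) P 1"
  by (auto simp: eigenmat_def intro!: eq_matI)

lemma eigenmat_smult:
  assumes P: "P \<in> carrier_mat n n" and A: "A \<in> carrier_mat n n" and e: "eigenmat A P a"
  shows "eigenmat (c \<cdot>\<^sub>m A) P (c * a)"
  using P A e mult_smult_distrib[OF P A] mult_smult_assoc_mat[OF A P]
  by (auto simp: eigenmat_def intro!: eq_matI)

context
  fixes n :: nat and P A B :: "'a::field mat"
  assumes P: "P \<in> carrier_mat n n" and A: "A \<in> carrier_mat n n" and B: "B \<in> carrier_mat n n"
begin

lemma eigenmat_add: "eigenmat A P a \<Longrightarrow> eigenmat B P b \<Longrightarrow> eigenmat (A + B) P (a + b)"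
  using add_mult_distrib_mat[OF A B P] mult_add_distrib_mat[OF P A B] P
  by (auto simp: eigenmat_def algebra_simps intro!: eq_matI)

lemma eigenmat_minus: "eigenmat A P a \<Longrightarrow> eigenmat B P b \<Longrightarrow> eigenmat (A - B) P (a - b)"
  using minus_mult_distrib_mat[OF A B P] mult_minus_distrib_mat[OF P A B] P
  by (auto simp: eigenmat_def algebra_simps intro!: eq_matI)

lemma eigenmat_mult:
  assumes "eigenmat A P a" "eigenmat B P b"
  shows "eigenmat (A * B) P (a * b)"
proof -
  have "A * B * P = a \<cdot>\<^sub>m (b \<cdot>\<^sub>m P)"
    using assms mult_smult_distrib[OF A P, of b] mult_smult_distrib[OF A P, of a]
    by (auto simp: eigenmat_def assoc_mult_mat[OF A B P] mult.commute intro!: eq_matI)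
  moreover have "P * (A * B) = a \<cdot>\<^sub>m (b \<cdot>\<^sub>m P)"
    using assms mult_smult_assoc_mat[OF P B, of a]
    by (auto simp: eigenmat_def assoc_mult_mat[OF P A B, symmetric])
  ultimately show ?thesis by (auto simp: eigenmat_def intro!: eq_matI)
qed

lemma eigenmat_inverse:
  assumes "eigenmat A P a" "a \<noteq> 0" "A * B = 1\<^sub>m n" "B * A = 1\<^sub>m n"
  shows "eigenmat B P (inverse a)"
proof -
  have 1: "P = a \<cdot>\<^sub>m (B * P)"
  proof -
    have "P = B * A * P" using P assms by simp
    also have "\<dots> = B * (A * P)" using A B P by simp
    also have "\<dots> = a \<cdot>\<^sub>m (B * P)" using assms mult_smult_distrib[OF B P] by (simp add: eigenmat_def)
    finally show ?thesis .
  qed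
  have 2: "P = a \<cdot>\<^sub>m (P * B)"
  proof -
    have "P = P * (A * B)" using P assms by simp
    also have "\<dots> = P * A * B" using A B P by simp
    also have "\<dots> = a \<cdot>\<^sub>m (P * B)" using assms mult_smult_assoc_mat[OF P B] by (simp add: eigenmat_def)
    finally show ?thesis .
  qed
  have c: "X = inverse a \<cdot>\<^sub>m (a \<cdot>\<^sub>m X)" for X :: "'a mat"
    using assms(2) by (auto intro!: eq_matI)
  show ?thesis unfolding eigenmat_def
    using c[of "B * P"] c[of "P * B"] 1 2 by simp
qed

end

text \<open>If \<open>v\<close> is an eigenvector, some \<open>P x\<close> does not kill it by
  \<open>ker\<close>, and the relation for \<open>P x * A\<close> applied to \<open>v\<close> forces
  its eigenvalue to be \<open>a x\<close>. Conversely, the relation for \<open>A * P x\<close> makes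
  every nonzero column of \<open>P x\<close> an eigenvector.\<close>

lemma spectrum_eq_eigenmat_values:
  fixes A :: "'a::field mat"
  assumes A: "A \<in> carrier_mat n n" and P: "\<And>x. x \<in> X \<Longrightarrow> P x \<in> carrier_mat n n"
    and e: "\<And>x. x \<in> X \<Longrightarrow> eigenmat A (P x) (a x)"
    and ker: "\<And>v. v \<in> carrier_vec n \<Longrightarrow> \<forall>x\<in>X. P x *\<^sub>v v = 0\<^sub>v n \<Longrightarrow> v = 0\<^sub>v n"
  shows "spectrum A = a ` {x \<in> X. P x \<noteq> 0\<^sub>m n n}"
proof (rule equalityI; rule subsetI)
  fix k assume "k \<in> spectrum A"
  then obtain v where v: "v \<in> carrier_vec n" "v \<noteq> 0\<^sub>v n" "A *\<^sub>v v = k \<cdot>\<^sub>v v"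
    using A by (auto simp: spectrum_def eigenvalue_def eigenvector_def)
  then obtain x where x: "x \<in> X" "P x *\<^sub>v v \<noteq> 0\<^sub>v n" using ker by blast
  have Px: "P x \<in> carrier_mat n n" using P x by blast
  have "k \<cdot>\<^sub>v (P x *\<^sub>v v) = P x *\<^sub>v (A *\<^sub>v v)" using v Px by (simp add: mult_mat_vec)
  also have "\<dots> = (P x * A) *\<^sub>v v" using v Px A by simp
  also have "P x * A = a x \<cdot>\<^sub>m P x" using e x by (simp add: eigenmat_def)
  finally have eq: "k \<cdot>\<^sub>v (P x *\<^sub>v v) = (a x \<cdot>\<^sub>m P x) *\<^sub>v v" .
  from x(2) Px obtain i where i: "i < n" "(P x *\<^sub>v v) $ i \<noteq> 0"
    by (metis carrier_matD(1) dim_mult_mat_vec eq_vecI index_zero_vec)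
  have "k * (P x *\<^sub>v v) $ i = a x * (P x *\<^sub>v v) $ i"
    using arg_cong[OF eq, of "\<lambda>w. w $ i"] i(1) Px v(1) by simp
  hence "k = a x" using i(2) by simp
  moreover have "P x \<noteq> 0\<^sub>m n n" using x(2) v(1) by auto
  ultimately show "k \<in> a ` {x \<in> X. P x \<noteq> 0\<^sub>m n n}" using x(1) by blast
next
  fix k assume "k \<in> a ` {x \<in> X. P x \<noteq> 0\<^sub>m n n}"
  then obtain x where x: "x \<in> X" "P x \<noteq> 0\<^sub>m n n" "k = a x" by blast
  have Px: "P x \<in> carrier_mat n n" using P x by blast
  then obtain j where j: "j < n" "col (P x) j \<noteq> 0\<^sub>v n"
    using x(2) by (metis carrier_matD(2) col_zero index_zero_mat(2,3) mat_col_eqI carrier_matD(1))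
  have "A *\<^sub>v col (P x) j = col (A * P x) j" using col_mult2[OF A Px j(1)] by simp
  also have "A * P x = k \<cdot>\<^sub>m P x" using e x by (simp add: eigenmat_def)
  also have "col (k \<cdot>\<^sub>m P x) j = k \<cdot>\<^sub>v col (P x) j" using Px j by simp
  finally show "k \<in> spectrum A" using j A Px
    by (auto simp: spectrum_def eigenvalue_def eigenvector_def intro!: exI[of _ "col (P x) j"])
qed

section \<open>Closure of the commutant of a matrix under algebraic operations\<close>

lemma commute_smult_one:
  fixes A :: "'a::comm_ring_1 mat"
  assumes A: "A \<in> carrier_mat n n"
  shows "A * (c \<cdot>\<^sub>m 1\<^sub>m n) = (c \<cdot>\<^sub>m 1\<^sub>m n) * A"
  using A mult_smult_distrib[OF A one_carrier_mat] mult_smult_assoc_mat[OF one_carrier_mat A] by simp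

context
  fixes n :: nat and A B C :: "'a::comm_ring_1 mat"
  assumes A: "A \<in> carrier_mat n n" and B: "B \<in> carrier_mat n n" and C: "C \<in> carrier_mat n n"
begin

lemma commute_mult: "A * B = B * A \<Longrightarrow> A * C = C * A \<Longrightarrow> A * (B * C) = (B * C) * A"
  using assoc_mult_mat[OF A B C] assoc_mult_mat[OF B A C] assoc_mult_mat[OF B C A] by simp

lemma commute_add: "A * B = B * A \<Longrightarrow> A * C = C * A \<Longrightarrow> A * (B + C) = (B + C) * A"
  using mult_add_distrib_mat[OF A B C] add_mult_distrib_mat[OF B C A] by simp

lemma commute_minus: "A * B = B * A \<Longrightarrow> A * C = C * A \<Longrightarrow> A * (B - C) = (B - C) * A"
  using mult_minus_distrib_mat[OF A B C] minus_mult_distrib_mat[OF B C A] by simp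

lemma commute_inverse:
  assumes "A * B = B * A" "B * C = 1\<^sub>m n" "C * B = 1\<^sub>m n"
  shows "A * C = C * A"
proof -
  have "A * C = C * B * (A * C)" using A B C assms by simp
  also have "\<dots> = C * (B * A) * C" using A B C by (simp add: assoc_mult_mat[of _ n n _ n _ n])
  also have "\<dots> = C * A * (B * C)"
    using A B C by (simp add: assms(1)[symmetric] assoc_mult_mat[of _ n n _ n _ n])
  also have "\<dots> = C * A" using A C assms by simp
  finally show ?thesis .
qed

end

text \<open>\<open>mat_inverse\<close> returns an option; a nonzero determinant rules out
  \<open>None\<close>, which gives the \<open>the\<close> in \<open>T_mat\<close> its intended
  meaning.\<close>

lemma the_mat_inverse:
  fixes A :: "'a::field mat"
  assumes A: "A \<in> carrier_mat n n" and d: "det A \<noteq> 0"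
  shows "the (mat_inverse A) \<in> carrier_mat n n" "A * the (mat_inverse A) = 1\<^sub>m n"
    "the (mat_inverse A) * A = 1\<^sub>m n"
proof -
  obtain B where "mat_inverse A = Some B"
    using mat_inverse(1)[OF A] det_non_zero_imp_unit[OF A d] by (metis option.exhaust)
  with mat_inverse(2)[OF A this]
  show "the (mat_inverse A) \<in> carrier_mat n n" "A * the (mat_inverse A) = 1\<^sub>m n"
    "the (mat_inverse A) * A = 1\<^sub>m n" by auto
qed

lemma invertible_matI:
  assumes "A \<in> carrier_mat n n" "A * B = 1\<^sub>m n" "B * A = 1\<^sub>m n"
  shows "invertible_mat A"
proof -
  have "dim_row B = n" using arg_cong[OF assms(3), of dim_row] by simp
  hence "inverts_mat A B \<and> inverts_mat B A" using assms by (simp add: inverts_mat_def)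
  moreover have "square_mat A" using assms(1) by simp
  ultimately show ?thesis unfolding invertible_mat_def by blast
qed

section \<open>Normality and spectrum of \<open>T\<close> for an abstract commuting pair\<close>

locale tangent_pair =
  fixes n :: nat and H S :: "real mat" and X :: "'x set" and P :: "'x \<Rightarrow> complex mat"
    and b :: "'x \<Rightarrow> real"
  assumes H: "H \<in> carrier_mat n n" and S: "S \<in> carrier_mat n n"
    and HS: "H * S = S * H" and SS: "S * S = - 1\<^sub>m n" and ST: "S\<^sup>T = - S" and HT: "H\<^sup>T = H"
    and P: "\<And>x. x \<in> X \<Longrightarrow> P x \<in> carrier_mat n n"
    and PH: "\<And>x. x \<in> X \<Longrightarrow> eigenmat (complex_mat H) (P x) (of_real (b x))"
    and PS: "\<And>x. x \<in> X \<Longrightarrow> P x * complex_mat S = complex_mat S * P x"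
    and P0: "\<And>x. x \<in> X \<Longrightarrow> P x \<noteq> 0\<^sub>m n n"
    and ker: "\<And>v. v \<in> carrier_vec n \<Longrightarrow> \<forall>x\<in>X. P x *\<^sub>v v = 0\<^sub>v n \<Longrightarrow> v = 0\<^sub>v n"
    and b: "\<And>x. x \<in> X \<Longrightarrow> b x > 0"
begin

lemma spectrum_H: "spectrum (complex_mat H) = (\<lambda>x. of_real (b x)) ` X"
  using spectrum_eq_eigenmat_values[of "complex_mat H" n X P "\<lambda>x. of_real (b x)"] H P PH P0 ker
  by auto

abbreviation "I \<equiv> 1\<^sub>m n :: real mat"

context
  fixes lam :: real assumes lam: "lam > 0"
begin

text \<open>Because \<open>S * S = - 1\<close>, the product of lam + S and lam - S is (lam^2 + 1)
  times the identity; the determinant of a product then settles the claim without any eigenvalues of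
  \<open>S\<close>.\<close>

lemma det_shift_S: "det (lam \<cdot>\<^sub>m I + S) \<noteq> 0"
proof -
  have "(lam \<cdot>\<^sub>m I + S) * (lam \<cdot>\<^sub>m I - S)
      = lam \<cdot>\<^sub>m I * (lam \<cdot>\<^sub>m I) - lam \<cdot>\<^sub>m I * S + (S * (lam \<cdot>\<^sub>m I) - S * S)"
    using S by (subst add_mult_distrib_mat[of _ n n _ _ n], simp_all add: mult_minus_distrib_mat[of _ n n _ n] minus_carrier_mat)
  also have "\<dots> = (lam * lam + 1) \<cdot>\<^sub>m I"
    unfolding SS using S mult_smult_distrib[OF S one_carrier_mat]
      mult_smult_assoc_mat[OF one_carrier_mat S]
      mult_smult_assoc_mat[OF one_carrier_mat, of "lam \<cdot>\<^sub>m I" n n]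
    by (auto intro!: eq_matI)
  finally have "det (lam \<cdot>\<^sub>m I + S) * det (lam \<cdot>\<^sub>m I - S) = (lam * lam + 1) ^ n"
    using S det_mult[of "lam \<cdot>\<^sub>m I + S" n "lam \<cdot>\<^sub>m I - S"] by (simp add: minus_carrier_mat)
  moreover have "lam * lam + 1 > 0" by (simp add: add_nonneg_pos)
  ultimately show ?thesis by (metis mult_zero_left power_not_zero less_irrefl)
qed

text \<open>A kernel vector would make - lam an eigenvalue of \<open>H\<close>, whereas
  \<open>spectrum_H\<close> contains only the positive numbers \<open>b x\<close>.\<close>

lemma det_shift_H: "det (lam \<cdot>\<^sub>m I + H) \<noteq> 0"
proof
  assume "det (lam \<cdot>\<^sub>m I + H) = 0"
  hence "det (complex_mat (lam \<cdot>\<^sub>m I + H)) = 0" by (simp add: of_real_hom.hom_det)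
  then obtain v where v: "v \<in> carrier_vec n" "v \<noteq> 0\<^sub>v n"
      "complex_mat (lam \<cdot>\<^sub>m I + H) *\<^sub>v v = 0\<^sub>v n"
    using det_0_iff_vec_prod_zero_field[of "complex_mat (lam \<cdot>\<^sub>m I + H)" n] H by auto
  have eq: "complex_mat (lam \<cdot>\<^sub>m I + H) = of_real lam \<cdot>\<^sub>m 1\<^sub>m n + complex_mat H"
    using H by (auto intro!: eq_matI)
  have "complex_mat H *\<^sub>v v = (- of_real lam) \<cdot>\<^sub>v v"
  proof (rule eq_vecI)
    fix i assume "i < dim_vec ((- complex_of_real lam) \<cdot>\<^sub>v v)"
    hence i: "i < n" using v by simp
    have "of_real lam * v $ i + (complex_mat H *\<^sub>v v) $ i = 0"
      using arg_cong[OF v(3), of "\<lambda>w. w $ i"] i v(1) H unfolding eq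
      by (simp add: add_mult_distrib_mat_vec[of _ n n])
    thus "(complex_mat H *\<^sub>v v) $ i = ((- complex_of_real lam) \<cdot>\<^sub>v v) $ i"
      using i v(1) by (simp add: add_eq_0_iff)
  qed (use H v in auto)
  hence "- of_real lam \<in> spectrum (complex_mat H)"
    using v H by (auto simp: spectrum_def eigenvalue_def eigenvector_def)
  then obtain x where "x \<in> X" "- complex_of_real lam = of_real (b x)"
    unfolding spectrum_H by auto
  moreover from this(2) have "- lam = b x" by (metis of_real_eq_iff of_real_minus)
  ultimately show False using b[of x] lam by simp
qed

definition "J = the (mat_inverse (lam \<cdot>\<^sub>m I + S))"
definition "G = the (mat_inverse (lam \<cdot>\<^sub>m I + H))"

lemma J: "J \<in> carrier_mat n n" "(lam \<cdot>\<^sub>m I + S) * J = I" "J * (lam \<cdot>\<^sub>m I + S) = I"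
  unfolding J_def using the_mat_inverse[OF _ det_shift_S] S by auto

lemma G: "G \<in> carrier_mat n n" "(lam \<cdot>\<^sub>m I + H) * G = I" "G * (lam \<cdot>\<^sub>m I + H) = I"
  unfolding G_def using the_mat_inverse[OF _ det_shift_H] H by auto

lemma invertible_shift: "invertible_mat (lam \<cdot>\<^sub>m I + S)" "invertible_mat (lam \<cdot>\<^sub>m I + H)"
  by (rule invertible_matI[OF add_carrier_mat[OF S] J(2,3)])
    (rule invertible_matI[OF add_carrier_mat[OF H] G(2,3)])

lemma T_mat_eq: "T_mat H S lam = J * (lam \<cdot>\<^sub>m I - H) * G * (lam \<cdot>\<^sub>m I - S)"
  using H by (simp add: T_mat_def J_def G_def Let_def)

lemma T_carrier: "T_mat H S lam \<in> carrier_mat n n"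
  unfolding T_mat_eq using J G H S by (metis minus_carrier_mat mult_carrier_mat)

text \<open>Every factor of \<open>T\<close> is formed from the identity, \<open>H\<close> and
  \<open>S\<close> by sums, differences and inverses, and all of these stay in the commutant of
  \<open>A\<close>. It is applied to \<open>H\<close>, to \<open>S\<close>, and finally to the
  transpose of \<open>T\<close>.\<close>

lemma commute_T:
  assumes A: "A \<in> carrier_mat n n" and AH: "A * H = H * A" and AS: "A * S = S * A"
  shows "A * T_mat H S lam = T_mat H S lam * A"
proof -
  note c = smult_carrier_mat[OF one_carrier_mat, of lam n]
  have 1: "A * (lam \<cdot>\<^sub>m I + S) = (lam \<cdot>\<^sub>m I + S) * A" "A * (lam \<cdot>\<^sub>m I + H) = (lam \<cdot>\<^sub>m I + H) * A"
    "A * (lam \<cdot>\<^sub>m I - S) = (lam \<cdot>\<^sub>m I - S) * A" "A * (lam \<cdot>\<^sub>m I - H) = (lam \<cdot>\<^sub>m I - H) * A"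
    using commute_add[OF A c S] commute_add[OF A c H] commute_minus[OF A c S] commute_minus[OF A c H]
      commute_smult_one[OF A, of lam] AH AS by auto
  have 2: "A * J = J * A" "A * G = G * A"
    using commute_inverse[OF A _ J(1) 1(1) J(2,3)] commute_inverse[OF A _ G(1) 1(2) G(2,3)] S H by auto
  have 3: "lam \<cdot>\<^sub>m I - S \<in> carrier_mat n n" "lam \<cdot>\<^sub>m I - H \<in> carrier_mat n n"
    using H S by auto
  show ?thesis unfolding T_mat_eq
    by (intro commute_mult[OF A] mult_carrier_mat[of _ n n] 1 2 3 J(1) G(1))
qed

text \<open>Transposing the commutation of \<open>T\<close> with \<open>H\<close> and
  \<open>S\<close> shows that its transpose commutes with both as well; the sign from the skew
  \<open>S\<close> occurs on both sides and cancels. Hence \<open>commute_T\<close> applies to the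
  transpose.\<close>

lemma normal_T_mat: "normal_mat (T_mat H S lam)"
proof -
  let ?T = "T_mat H S lam"
  have HT': "H * ?T = ?T * H" using commute_T[OF H] HS by simp
  have ST': "S * ?T = ?T * S" using commute_T[OF S] HS by simp
  have "?T\<^sup>T * H = H * ?T\<^sup>T"
    using arg_cong[OF HT', of transpose_mat] transpose_mult[OF H T_carrier]
      transpose_mult[OF T_carrier H] HT by simp
  moreover have "?T\<^sup>T * S = S * ?T\<^sup>T"
    using arg_cong[OF ST', of transpose_mat] transpose_mult[OF S T_carrier]
      transpose_mult[OF T_carrier S] ST S T_carrier by simp
  ultimately have "?T\<^sup>T * ?T = ?T * ?T\<^sup>T" using commute_T[of "?T\<^sup>T"] T_carrier by simp
  thus ?thesis by (simp add: normal_mat_def)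
qed

text \<open>
  For \<open>s = \<i>\<close> or \<open>s = -\<i>\<close>, \<open>Q x s\<close> is \<open>2 s\<close> times the part of \<open>P x\<close> in the \<open>s\<close>-eigenspace of \<open>S\<close>,
  because \<open>S\<^sup>2 = -1\<close>.
\<close>

definition "Q x s = P x * complex_mat S + s \<cdot>\<^sub>m P x"

text \<open>The value of the product defining \<open>T\<close> when \<open>H\<close> is replaced by
  \<open>b x\<close> and \<open>S\<close> by \<open>s\<close>, factor by factor in the same
  order.\<close>

definition "\<tau> x s = inverse (of_real lam + s) * (of_real lam - of_real (b x))
  * inverse (of_real lam + of_real (b x)) * (of_real lam - s)"

lemma Q: assumes "x \<in> X" shows "Q x s \<in> carrier_mat n n"
  using P[OF assms] S by (simp add: Q_def)

text \<open>The terms with \<open>S\<close> cancel, so \<open>P x\<close> is recovered from its two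
  parts. This transfers both the trivial joint kernel and the nonvanishing from the family
  \<open>P\<close> to the family \<open>Q\<close>.\<close>

lemma Q_diff:
  assumes x: "x \<in> X" and v: "v \<in> carrier_vec n"
  shows "Q x \<i> *\<^sub>v v - Q x (- \<i>) *\<^sub>v v = (2 * \<i>) \<cdot>\<^sub>v (P x *\<^sub>v v)"
proof -
  have "Q x s *\<^sub>v v = (P x * complex_mat S) *\<^sub>v v + s \<cdot>\<^sub>v (P x *\<^sub>v v)" for s
    unfolding Q_def using P[OF x] S v by (subst add_mult_distrib_mat_vec[of _ n n]) auto
  thus ?thesis using P[OF x] S v by (auto intro!: eq_vecI)
qed

text \<open>With \<open>S * S = - 1\<close> and s^2 = -1, the product Q S is - P + s P S = s (P S +
  s P). The product in the other order agrees with it because \<open>P x\<close> commutes with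
  \<open>S\<close>.\<close>

lemma eigenmat_S_Q:
  assumes x: "x \<in> X" and s: "s * s = -1"
  shows "eigenmat (complex_mat S) (Q x s) s"
proof -
  let ?S = "complex_mat S"
  have Sc: "?S \<in> carrier_mat n n" using S by simp
  note Pc = P[OF x]
  have SS': "?S * ?S = - 1\<^sub>m n"
    unfolding of_real_hom.mat_hom_mult[OF S S, symmetric] SS by (auto intro!: eq_matI)
  have 1: "Q x s * ?S = P x * (?S * ?S) + s \<cdot>\<^sub>m (P x * ?S)"
    unfolding Q_def using Pc Sc mult_smult_assoc_mat[OF Pc Sc]
    by (subst add_mult_distrib_mat[of _ n n _ _ n]) auto
  have "P x * (?S * ?S) = - P x" unfolding SS' using Pc by simp
  hence 2: "Q x s * ?S = s \<cdot>\<^sub>m Q x s"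
    unfolding 1 unfolding Q_def using Pc Sc s
    by (auto intro!: eq_matI simp: algebra_simps mult.assoc[symmetric])
  have "?S * Q x s = ?S * (P x * ?S) + ?S * (s \<cdot>\<^sub>m P x)"
    unfolding Q_def using Pc Sc by (subst mult_add_distrib_mat[of _ n n _ n]) auto
  also have "\<dots> = Q x s * ?S"
    unfolding 1 mult_smult_distrib[OF Sc Pc] PS[OF x, symmetric]
    by (simp add: assoc_mult_mat[OF Sc Pc Sc, symmetric] assoc_mult_mat[OF Pc Sc Sc, symmetric]
        PS[OF x, symmetric] del: assoc_mult_mat)
  finally show ?thesis using 2 by (simp add: eigenmat_def)
qed

lemma eigenmat_H_Q:
  assumes x: "x \<in> X"
  shows "eigenmat (complex_mat H) (Q x s) (of_real (b x))"
proof -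
  let ?S = "complex_mat S" and ?H = "complex_mat H"
  have Sc: "?S \<in> carrier_mat n n" and Hc: "?H \<in> carrier_mat n n" using S H by auto
  note Pc = P[OF x]
  have HSc: "?H * ?S = ?S * ?H"
    using arg_cong[OF HS, of complex_mat]
    by (simp add: of_real_hom.mat_hom_mult[OF S H] of_real_hom.mat_hom_mult[OF H S])
  have e: "?H * P x = of_real (b x) \<cdot>\<^sub>m P x" "P x * ?H = of_real (b x) \<cdot>\<^sub>m P x"
    using PH[OF x] by (auto simp: eigenmat_def)
  have "?H * Q x s = (?H * P x) * ?S + s \<cdot>\<^sub>m (?H * P x)"
    unfolding Q_def using Pc Sc Hc mult_smult_distrib[OF Hc Pc]
    by (subst mult_add_distrib_mat[of _ n n _ n]) auto
  hence 1: "?H * Q x s = of_real (b x) \<cdot>\<^sub>m Q x s"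
    unfolding e Q_def using Pc Sc mult_smult_assoc_mat[OF Pc Sc]
    by (auto intro!: eq_matI simp: algebra_simps)
  have "Q x s * ?H = (P x * ?H) * ?S + s \<cdot>\<^sub>m (P x * ?H)"
    unfolding Q_def using Pc Sc Hc mult_smult_assoc_mat[OF Pc Hc]
    by (subst add_mult_distrib_mat[of _ n n _ _ n]) (auto simp: HSc)
  hence "Q x s * ?H = of_real (b x) \<cdot>\<^sub>m Q x s"
    unfolding e Q_def using Pc Sc mult_smult_assoc_mat[OF Pc Sc]
    by (auto intro!: eq_matI simp: algebra_simps)
  with 1 show ?thesis by (simp add: eigenmat_def)
qed

lemma eigenmat_T_Q:
  assumes x: "x \<in> X" and s: "s * s = -1"
  shows "eigenmat (complex_mat (T_mat H S lam)) (Q x s) (\<tau> x s)"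
proof -
  let ?S = "complex_mat S" and ?H = "complex_mat H" and ?J = "complex_mat J" and ?G = "complex_mat G"
  let ?l = "of_real lam \<cdot>\<^sub>m 1\<^sub>m n :: complex mat"
  have c: "?S \<in> carrier_mat n n" "?H \<in> carrier_mat n n" "?J \<in> carrier_mat n n" "?G \<in> carrier_mat n n"
    "?l \<in> carrier_mat n n"
    using S H J G by auto
  have c2: "?l + ?S \<in> carrier_mat n n" "?l + ?H \<in> carrier_mat n n" "?l - ?S \<in> carrier_mat n n"
    "?l - ?H \<in> carrier_mat n n" using c by auto
  have sh: "complex_mat (lam \<cdot>\<^sub>m I + S) = ?l + ?S" "complex_mat (lam \<cdot>\<^sub>m I + H) = ?l + ?H"
    "complex_mat (lam \<cdot>\<^sub>m I - S) = ?l - ?S" "complex_mat (lam \<cdot>\<^sub>m I - H) = ?l - ?H"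
    using S H by (auto intro!: eq_matI)
  have inv: "(?l + ?S) * ?J = 1\<^sub>m n" "?J * (?l + ?S) = 1\<^sub>m n" "(?l + ?H) * ?G = 1\<^sub>m n" "?G * (?l + ?H) = 1\<^sub>m n"
    unfolding sh[symmetric] using S H J G
    by (simp_all add: of_real_hom.mat_hom_mult[of _ n n _ n, symmetric] of_real_hom.mat_hom_one)
  have T: "complex_mat (T_mat H S lam) = ?J * (?l - ?H) * ?G * (?l - ?S)"
  proof -
    have "lam \<cdot>\<^sub>m I - H \<in> carrier_mat n n" "lam \<cdot>\<^sub>m I - S \<in> carrier_mat n n" using H S by auto
    note r = J(1) G(1) this
    have "J * (lam \<cdot>\<^sub>m I - H) \<in> carrier_mat n n" "J * (lam \<cdot>\<^sub>m I - H) * G \<in> carrier_mat n n"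
      using r by (metis mult_carrier_mat)+
    note r = r this
    show ?thesis unfolding T_mat_eq sh[symmetric]
      by (simp only: of_real_hom.mat_hom_mult[OF r(6) r(4)] of_real_hom.mat_hom_mult[OF r(5) r(2)]
          of_real_hom.mat_hom_mult[OF r(1) r(3)])
  qed
  note q = Q[OF x, of s]
  have l: "eigenmat ?l (Q x s) (of_real lam)"
    using eigenmat_smult[OF q one_carrier_mat eigenmat_one[OF q], of "of_real lam"]
    by simp
  note eS = eigenmat_S_Q[OF x s] and eH = eigenmat_H_Q[OF x, of s]
  have n0: "of_real lam + s \<noteq> 0"
  proof
    assume "of_real lam + s = 0"
    hence "s = - of_real lam" by (simp add: add_eq_0_iff)
    hence "Re (s * s) = lam * lam" by simp
    hence "lam * lam = -1" unfolding s by simp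
    moreover have "lam * lam > 0" using lam by simp
    ultimately show False by linarith
  qed
  have n1: "complex_of_real lam + of_real (b x) \<noteq> 0"
    using lam b[OF x] by (metis add_pos_pos less_irrefl of_real_add of_real_eq_0_iff)
  show ?thesis unfolding T \<tau>_def
    by (intro eigenmat_mult[OF q] mult_carrier_mat[of _ n n] c c2
        eigenmat_inverse[OF q c2(1) c(3) _ n0 inv(1,2)] eigenmat_inverse[OF q c2(2) c(4) _ n1 inv(3,4)]
        eigenmat_add[OF q] eigenmat_minus[OF q] l eS eH)
qed

text \<open>For real lam and s = i or s = - i the numbers lam - s and lam + s are complex
  conjugates, so the factor contributed by \<open>S\<close> has modulus one.\<close>

lemma cmod_\<tau>:
  assumes "s = \<i> \<or> s = - \<i>"
  shows "cmod (\<tau> x s) = cmod ((of_real lam - of_real (b x)) / (of_real lam + of_real (b x)))"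
proof -
  have "cmod (of_real lam - s) = cmod (of_real lam + s)" "cmod (of_real lam + s) \<noteq> 0"
    using assms lam by (auto simp: cmod_def add_nonneg_eq_0_iff)
  thus ?thesis by (simp add: \<tau>_def norm_mult norm_divide norm_inverse divide_inverse)
qed

text \<open>Each mode is split by the two eigenvalues of \<open>S\<close>. Only moduli are compared,
  so it suffices that for each \<open>x\<close> at least one of the two parts survives.\<close>

lemma norm_spectrum_T:
  "cmod ` spectrum (complex_mat (T_mat H S lam))
     = (\<lambda>\<mu>. cmod ((of_real lam - \<mu>) / (of_real lam + \<mu>))) ` spectrum (complex_mat H)"
proof -
  let ?Y = "X \<times> {\<i>, - \<i>}"
  have sp: "spectrum (complex_mat (T_mat H S lam))
      = (\<lambda>y. \<tau> (fst y) (snd y)) ` {y \<in> ?Y. Q (fst y) (snd y) \<noteq> 0\<^sub>m n n}"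
  proof (rule spectrum_eq_eigenmat_values)
    show "complex_mat (T_mat H S lam) \<in> carrier_mat n n" using T_carrier by simp
    show "\<And>y. y \<in> ?Y \<Longrightarrow> Q (fst y) (snd y) \<in> carrier_mat n n" using Q by auto
    show "\<And>y. y \<in> ?Y \<Longrightarrow> eigenmat (complex_mat (T_mat H S lam)) (Q (fst y) (snd y)) (\<tau> (fst y) (snd y))"
      using eigenmat_T_Q by auto
    fix v :: "complex Matrix.vec" assume v: "v \<in> carrier_vec n" "\<forall>y\<in>?Y. Q (fst y) (snd y) *\<^sub>v v = 0\<^sub>v n"
    have "P x *\<^sub>v v = 0\<^sub>v n" if x: "x \<in> X" for x
    proof -
      have "(2 * \<i>) \<cdot>\<^sub>v (P x *\<^sub>v v) = 0\<^sub>v n" using Q_diff[OF x v(1)] v(2) x by simp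
      thus ?thesis using P[OF x] by (auto simp: Matrix.vec_eq_iff)
    qed
    thus "v = 0\<^sub>v n" using ker[OF v(1)] by blast
  qed
  \<comment> \<open>If both parts vanished, \<open>Q_diff\<close> applied to the unit vectors would
    annihilate every column of \<open>P x\<close>.\<close>
  have ex: "\<exists>s\<in>{\<i>, - \<i>}. Q x s \<noteq> 0\<^sub>m n n" if x: "x \<in> X" for x
  proof (rule ccontr)
    assume "\<not> ?thesis"
    hence z: "Q x \<i> = 0\<^sub>m n n" "Q x (- \<i>) = 0\<^sub>m n n" by auto
    have "P x = 0\<^sub>m n n"
    proof (rule mat_col_eqI)
      fix j assume "j < dim_col (0\<^sub>m n n :: complex mat)"
      hence j: "j < n" by simp
      have "(2 * \<i>) \<cdot>\<^sub>v (P x *\<^sub>v unit_vec n j) = 0\<^sub>v n"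
        unfolding Q_diff[OF x unit_vec_carrier, symmetric] z by (auto intro!: eq_vecI)
      hence "P x *\<^sub>v unit_vec n j = 0\<^sub>v n" using P[OF x] by (auto simp: Matrix.vec_eq_iff)
      moreover have "P x *\<^sub>v unit_vec n j = col (P x) j"
        using P[OF x] j by (auto intro!: eq_vecI simp: scalar_prod_right_unit)
      ultimately show "col (P x) j = col (0\<^sub>m n n) j" using j by simp
    qed (use P[OF x] in auto)
    thus False using P0[OF x] by simp
  qed
  show ?thesis unfolding sp spectrum_H image_image
  proof (rule equalityI; rule subsetI)
    fix r assume "r \<in> (\<lambda>y. cmod (\<tau> (fst y) (snd y))) ` {y \<in> ?Y. Q (fst y) (snd y) \<noteq> 0\<^sub>m n n}"
    thus "r \<in> (\<lambda>x. cmod ((of_real lam - of_real (b x)) / (of_real lam + of_real (b x)))) ` X"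
      using cmod_\<tau> by auto
  next
    fix r assume "r \<in> (\<lambda>x. cmod ((of_real lam - of_real (b x)) / (of_real lam + of_real (b x)))) ` X"
    then obtain x where x: "x \<in> X" "r = cmod ((of_real lam - of_real (b x)) / (of_real lam + of_real (b x)))" by auto
    from ex[OF x(1)] obtain s where "s \<in> {\<i>, - \<i>}" "Q x s \<noteq> 0\<^sub>m n n" by blast
    thus "r \<in> (\<lambda>y. cmod (\<tau> (fst y) (snd y))) ` {y \<in> ?Y. Q (fst y) (snd y) \<noteq> 0\<^sub>m n n}"
      using x cmod_\<tau>[of s x] by (intro image_eqI[of _ _ "(x, s)"]) auto
  qed
qed

end
end

section \<open>Kronecker products and tangent bases\<close>

text \<open>The left factor acts on nodes and the right one on components: block size
  \<open>dim_row B\<close> gives the numbering \<open>3 * i + p\<close> of the unknowns.\<close>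

definition kron :: "'a::semiring_0 mat \<Rightarrow> 'a mat \<Rightarrow> 'a mat" where
  "kron A B = Matrix.mat (dim_row A * dim_row B) (dim_col A * dim_col B)
     (\<lambda>(r, s). A $$ (r div dim_row B, s div dim_col B) * B $$ (r mod dim_row B, s mod dim_col B))"

lemma div_mod_bounds:
  fixes i a p :: nat
  assumes "i < a * p"
  shows "i div p < a" "i mod p < p"
proof -
  show "i div p < a" using assms by (simp add: less_mult_imp_div_less)
  have "p > 0" using assms by (intro gr0I) simp
  thus "i mod p < p" by simp
qed

lemma kron_carrier:
  "A \<in> carrier_mat a b \<Longrightarrow> B \<in> carrier_mat p q \<Longrightarrow> kron A B \<in> carrier_mat (a * p) (b * q)"
  by (auto simp: kron_def)

lemma kron_index:
  "A \<in> carrier_mat a b \<Longrightarrow> B \<in> carrier_mat p q \<Longrightarrow> i < a * p \<Longrightarrow> j < b * q \<Longrightarrow>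
   kron A B $$ (i, j) = A $$ (i div p, j div q) * B $$ (i mod p, j mod q)"
  by (auto simp: kron_def)

lemma sum_div_mod:
  "(\<Sum>k = 0..<b * q. f (k div q) (k mod q)) = (\<Sum>u = 0..<b. \<Sum>v = 0..<q. f u v)"
  for f :: "nat \<Rightarrow> nat \<Rightarrow> 'a::comm_monoid_add"
proof -
  have "(\<Sum>k = m * q..<m * q + q. f (k div q) (k mod q)) = (\<Sum>v = 0..<q. f m v)" for m
    by (subst sum.atLeastLessThan_shift_0) (auto intro!: sum.cong)
  thus ?thesis
    using sum.nat_group[of "\<lambda>k. f (k div q) (k mod q)" q b]
    by (simp add: lessThan_atLeast0)
qed

text \<open>The mixed-product rule: the contraction index splits by \<open>sum_div_mod\<close> into
  a quotient and a remainder, and the double sum is a product of two sums.\<close>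

lemma kron_mult:
  fixes A :: "'a::comm_semiring_0 mat"
  assumes A: "A \<in> carrier_mat a b" and B: "B \<in> carrier_mat p q"
    and C: "C \<in> carrier_mat b c" and D: "D \<in> carrier_mat q r"
  shows "kron A B * kron C D = kron (A * C) (B * D)"
proof (rule eq_matI)
  note c = kron_carrier[OF A B] kron_carrier[OF C D] kron_carrier[of "A * C" a c "B * D" p r]
  have AC: "A * C \<in> carrier_mat a c" and BD: "B * D \<in> carrier_mat p r" using A B C D by auto
  fix i j assume "i < dim_row (kron (A * C) (B * D))" "j < dim_col (kron (A * C) (B * D))"
  hence i: "i < a * p" and j: "j < c * r" using A B C D by (auto simp: kron_def)
  note i' = div_mod_bounds[OF i] and j' = div_mod_bounds[OF j]
  have "(kron A B * kron C D) $$ (i, j) = (\<Sum>k = 0..<b * q. kron A B $$ (i, k) * kron C D $$ (k, j))"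
    using c i j by (simp add: scalar_prod_def)
  also have "\<dots> = (\<Sum>k = 0..<b * q. (A $$ (i div p, k div q) * C $$ (k div q, j div r))
      * (B $$ (i mod p, k mod q) * D $$ (k mod q, j mod r)))"
    using kron_index[OF A B i] kron_index[OF C D _ j]
    by (intro sum.cong) (auto simp: mult_ac)
  also have "\<dots> = (\<Sum>u = 0..<b. \<Sum>v = 0..<q. (A $$ (i div p, u) * C $$ (u, j div r))
      * (B $$ (i mod p, v) * D $$ (v, j mod r)))"
    by (rule sum_div_mod)
  also have "\<dots> = (A * C) $$ (i div p, j div r) * (B * D) $$ (i mod p, j mod r)"
    using A B C D i' j' by (simp add: scalar_prod_def sum_product)
  also have "\<dots> = kron (A * C) (B * D) $$ (i, j)" using kron_index[OF AC BD i j] by simp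
  finally show "(kron A B * kron C D) $$ (i, j) = kron (A * C) (B * D) $$ (i, j)" .
qed (use A B C D in \<open>auto simp: kron_def\<close>)

lemma kron_transpose: "(kron A B)\<^sup>T = kron A\<^sup>T B\<^sup>T"
  by (rule eq_matI) (auto simp: kron_def div_mod_bounds)

lemma kron_one: "kron (1\<^sub>m n) (1\<^sub>m p) = (1\<^sub>m (n * p) :: 'a::semiring_1 mat)"
proof (rule eq_matI)
  fix i j assume "i < dim_row (1\<^sub>m (n * p) :: 'a mat)" "j < dim_col (1\<^sub>m (n * p) :: 'a mat)"
  hence ij: "i < n * p" "j < n * p" by auto
  moreover have "i = j \<longleftrightarrow> i div p = j div p \<and> i mod p = j mod p" by (metis div_mult_mod_eq)
  ultimately show "kron (1\<^sub>m n) (1\<^sub>m p) $$ (i, j) = (1\<^sub>m (n * p) :: 'a mat) $$ (i, j)"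
    using div_mod_bounds[of i n p] div_mod_bounds[of j n p] by (auto simp: kron_def)
qed (auto simp: kron_def)

lemma kron_minus_right:
  fixes A :: "'a::ring mat"
  assumes "A \<in> carrier_mat a b" "B \<in> carrier_mat p q" "C \<in> carrier_mat p q"
  shows "kron A (B - C) = kron A B - kron A C"
proof (rule eq_matI)
  fix i j assume "i < dim_row (kron A B - kron A C)" "j < dim_col (kron A B - kron A C)"
  hence ij: "i < a * p" "j < b * q" using assms by (auto simp: kron_def)
  have "(B - C) $$ (i mod p, j mod q) = B $$ (i mod p, j mod q) - C $$ (i mod p, j mod q)"
    using assms div_mod_bounds[OF ij(1)] div_mod_bounds[OF ij(2)] by simp
  thus "kron A (B - C) $$ (i, j) = (kron A B - kron A C) $$ (i, j)"
    using ij assms by (simp add: kron_def Rings.right_diff_distrib)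
qed (use assms in \<open>auto simp: kron_def\<close>)

lemma kron_uminus_right:
  fixes A :: "'a::ring mat"
  shows "kron A (- B) = - kron A B"
  by (intro eq_matI) (auto simp: kron_def div_mod_bounds)

lemma kron_smult_left:
  fixes A :: "'a::semiring_0 mat"
  shows "kron (c \<cdot>\<^sub>m A) B = c \<cdot>\<^sub>m kron A B"
  by (intro eq_matI) (auto simp: kron_def div_mod_bounds mult.assoc)

lemma complex_mat_kron: "complex_mat (kron A B) = kron (complex_mat A) (complex_mat B)"
  by (intro eq_matI) (auto simp: kron_def div_mod_bounds)

lemma diag_block_mat_replicate:
  fixes X :: "'a::semiring_1 mat"
  shows "diag_block_mat (replicate n X) = kron (1\<^sub>m n) X"
proof (induction n)
  case (Suc n)
  \<comment> \<open>Behind the first block the remainder of an index is unchanged and its quotient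
    drops by one. The upper bound in \<open>d\<close> serves to exclude blocks of size zero.\<close>
  have m: "(i - p) mod p = i mod p" if "\<not> i < p" for i p :: nat
    using that by (simp add: le_mod_geq[symmetric])
  have d: "i div p = Suc ((i - p) div p)" if "\<not> i < p" "i < p + n * p" for i p :: nat
    using that by (intro le_div_geq) (auto intro: gr0I)
  show ?case
    unfolding replicate_Suc diag_block_mat.simps Suc Let_def
  proof (rule eq_matI)
    fix i j assume "i < dim_row (kron (1\<^sub>m (Suc n)) X)" "j < dim_col (kron (1\<^sub>m (Suc n)) X)"
    hence ij: "i < dim_row X + n * dim_row X" "j < dim_col X + n * dim_col X" by (auto simp: kron_def)
    hence k: "kron (1\<^sub>m (Suc n)) X $$ (i, j)
        = (if i div dim_row X = j div dim_col X then X $$ (i mod dim_row X, j mod dim_col X) else 0)"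
      using div_mod_bounds[of i "Suc n" "dim_row X"] div_mod_bounds[of j "Suc n" "dim_col X"]
      by (auto simp: kron_def)
    have k': "kron (1\<^sub>m n) X $$ (i - dim_row X, j - dim_col X)
        = (if (i - dim_row X) div dim_row X = (j - dim_col X) div dim_col X
           then X $$ (i mod dim_row X, j mod dim_col X) else 0)"
      if "\<not> i < dim_row X" "\<not> j < dim_col X"
      using that ij div_mod_bounds[of "i - dim_row X" n "dim_row X"]
        div_mod_bounds[of "j - dim_col X" n "dim_col X"]
      by (auto simp: kron_def m)
    have dims: "dim_row (kron (1\<^sub>m n) X) = n * dim_row X" "dim_col (kron (1\<^sub>m n) X) = n * dim_col X"
      by (auto simp: kron_def)
    show "four_block_mat X (0\<^sub>m (dim_row X) (dim_col (kron (1\<^sub>m n) X)))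
        (0\<^sub>m (dim_row (kron (1\<^sub>m n) X)) (dim_col X)) (kron (1\<^sub>m n) X) $$ (i, j)
      = kron (1\<^sub>m (Suc n)) X $$ (i, j)"
      using ij unfolding k by (simp add: dims k' d)
  qed (auto simp: kron_def)
qed (auto simp: kron_def)

lemma componentwise_eq_kron: "componentwise A = kron A (1\<^sub>m 3)"
proof (rule eq_matI)
  fix i j assume "i < dim_row (kron A (1\<^sub>m 3))" "j < dim_col (kron A (1\<^sub>m 3))"
  hence "i < dim_row A * 3" "j < dim_col A * 3" by (auto simp: kron_def)
  thus "componentwise A $$ (i, j) = kron A (1\<^sub>m 3) $$ (i, j)"
    by (simp add: componentwise_def kron_def)
qed (simp_all add: componentwise_def kron_def)

section \<open>Matrices of the cross product and of the tangent projection in three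
  dimensions\<close>

lemma sum3: "(\<Sum>k = 0..<3. f k) = f 0 + f 1 + f (2::nat)" for f :: "nat \<Rightarrow> 'a::comm_monoid_add"
  by (simp add: numeral_3_eq_3 numeral_2_eq_2)

lemma less3: "i < 3 \<longleftrightarrow> i = 0 \<or> i = 1 \<or> i = (2::nat)" by auto

definition comp3 :: "real^3 \<Rightarrow> nat \<Rightarrow> real" where
  "comp3 a i = (if i = 0 then vec_nth a 1 else if i = 1 then vec_nth a 2 else vec_nth a 3)"

lemma vec_of_R3_carrier: "vec_of_R3 a \<in> carrier_vec 3" "dim_vec (vec_of_R3 a) = 3"
proof -
  show "dim_vec (vec_of_R3 a) = 3" unfolding vec_of_R3_def dim_vec_of_list by simp
  thus "vec_of_R3 a \<in> carrier_vec 3" by (rule carrier_vecI)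
qed

lemma vec_of_R3_index: "i < 3 \<Longrightarrow> vec_index (vec_of_R3 a) i = comp3 a i"
  unfolding less3 by (elim disjE) (simp_all add: vec_of_R3_def comp3_def vec_of_list_index numeral_2_eq_2)

lemma scalar_prod_vec_of_R3: "scalar_prod (vec_of_R3 a) (vec_of_R3 c) = inner a c"
  by (simp add: scalar_prod_def vec_of_R3_carrier sum3 vec_of_R3_index inner_vec_def sum_3 comp3_def)

lemma vec_of_R3_surj: "v \<in> carrier_vec 3 \<Longrightarrow> \<exists>a. v = vec_of_R3 a"
proof (rule exI, rule eq_vecI)
  let ?a = "vector [vec_index v 0, vec_index v 1, vec_index v 2] :: real^3"
  assume v: "v \<in> carrier_vec 3"
  show "vec_index v i = vec_index (vec_of_R3 ?a) i" if "i < dim_vec (vec_of_R3 ?a)" for i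
  proof -
    have i: "i < 3" using that by (simp add: vec_of_R3_carrier)
    show ?thesis unfolding vec_of_R3_index[OF i] using i unfolding less3
      by (elim disjE) (simp_all add: comp3_def vector_3)
  qed
qed (simp add: vec_of_R3_carrier)

definition row_mat :: "real^3 \<Rightarrow> real mat" where
  "row_mat m = mat_of_rows 3 [vec_of_R3 m]"

definition proj_mat :: "real^3 \<Rightarrow> real mat" where
  "proj_mat m = 1\<^sub>m 3 - (row_mat m)\<^sup>T * row_mat m"

lemma row_mat_carrier: "row_mat m \<in> carrier_mat 1 3"
  by (auto simp: row_mat_def)

lemma row_mat_index: "j < 3 \<Longrightarrow> row_mat m $$ (0, j) = comp3 m j"
  by (simp add: row_mat_def mat_of_rows_index vec_of_R3_index)

lemma cross_mat_carrier: "cross_mat m \<in> carrier_mat 3 3"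
  by (auto simp: cross_mat_def)

lemma proj_mat_carrier: "proj_mat m \<in> carrier_mat 3 3"
  unfolding proj_mat_def using row_mat_carrier[of m] by (intro minus_carrier_mat mult_carrier_mat) auto

text \<open>The cyclic form of the skew matrix of m; with it the 3 by 3 identities below reduce to
  nine polynomial identities each.\<close>

lemma cross_mat_index:
  "i < 3 \<Longrightarrow> j < 3 \<Longrightarrow> cross_mat m $$ (i, j) =
    (if i = j then 0 else if j = (i + 1) mod 3 then - comp3 m ((i + 2) mod 3) else comp3 m ((i + 1) mod 3))"
  by (auto simp: cross_mat_def mat_of_cols_index less3 vec_of_R3_index comp3_def cross_components axis_def)

lemma proj_mat_index:
  "i < 3 \<Longrightarrow> j < 3 \<Longrightarrow> proj_mat m $$ (i, j) = (if i = j then 1 else 0) - comp3 m i * comp3 m j"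
  using row_mat_carrier[of m] by (auto simp: proj_mat_def scalar_prod_def row_mat_index)

lemma mult_index3:
  "A \<in> carrier_mat 3 3 \<Longrightarrow> B \<in> carrier_mat 3 3 \<Longrightarrow> i < 3 \<Longrightarrow> j < 3 \<Longrightarrow>
   (A * B) $$ (i, j) = A $$ (i, 0) * B $$ (0, j) + A $$ (i, 1) * B $$ (1, j) + A $$ (i, 2) * B $$ (2, j)"
  by (simp add: scalar_prod_def sum3)

lemma cross_mat_transpose: "(cross_mat m)\<^sup>T = - cross_mat m"
proof (rule eq_matI)
  fix i j assume "i < dim_row (- cross_mat m)" "j < dim_col (- cross_mat m)"
  hence "i < 3" "j < 3" using cross_mat_carrier[of m] by auto
  thus "(cross_mat m)\<^sup>T $$ (i, j) = (- cross_mat m) $$ (i, j)"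
    using cross_mat_carrier[of m] unfolding less3 by (elim disjE) (simp_all add: cross_mat_index)
qed (use cross_mat_carrier[of m] in auto)

text \<open>Turns the plane in \<open>spatially_constant_basis\<close> into a kernel, so that one
  criterion for orthonormal kernel bases covers a single node and the whole grid.\<close>

lemma kernel_row_mat: "mat_kernel (row_mat m) = vec_of_R3 ` {a. inner m a = 0}"
proof -
  have "row_mat m *\<^sub>v vec_of_R3 a = 0\<^sub>v 1 \<longleftrightarrow> inner m a = 0" for a
  proof -
    have "row_mat m *\<^sub>v vec_of_R3 a = Matrix.vec 1 (\<lambda>_. inner m a)"
      using row_mat_carrier[of m] by (intro eq_vecI) (auto simp: row_mat_def scalar_prod_vec_of_R3 vec_of_R3_carrier)
    thus ?thesis by (auto simp: Matrix.vec_eq_iff)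
  qed
  thus ?thesis unfolding mat_kernel[OF row_mat_carrier]
    using vec_of_R3_surj vec_of_R3_carrier by blast
qed

context
  fixes m :: "real^3" assumes m: "norm m = 1"
begin

lemma comp3_norm: "comp3 m 0 * comp3 m 0 + comp3 m 1 * comp3 m 1 + comp3 m 2 * comp3 m 2 = 1"
  using m by (simp add: norm_eq_1 inner_vec_def sum_3 comp3_def)

lemma row_mat_norm: "row_mat m * (row_mat m)\<^sup>T = 1\<^sub>m 1"
  using row_mat_carrier[of m] comp3_norm
  by (intro eq_matI) (auto simp: scalar_prod_def sum3 row_mat_index)

text \<open>The vector m x a is orthogonal to m, so the projection fixes it.\<close>

lemma proj_cross: "proj_mat m * cross_mat m = cross_mat m"
proof (rule eq_matI)
  fix i j assume "i < dim_row (cross_mat m)" "j < dim_col (cross_mat m)"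
  hence ij: "i < 3" "j < 3" using cross_mat_carrier[of m] by auto
  show "(proj_mat m * cross_mat m) $$ (i, j) = cross_mat m $$ (i, j)"
    unfolding mult_index3[OF proj_mat_carrier cross_mat_carrier ij]
    using ij unfolding less3
    by (elim disjE) (simp_all add: proj_mat_index cross_mat_index algebra_simps numeral_2_eq_2[symmetric])
qed (use proj_mat_carrier[of m] cross_mat_carrier[of m] in auto)

text \<open>Since m x m = 0, removing the normal component first changes nothing.\<close>

lemma cross_proj: "cross_mat m * proj_mat m = cross_mat m"
proof (rule eq_matI)
  fix i j assume "i < dim_row (cross_mat m)" "j < dim_col (cross_mat m)"
  hence ij: "i < 3" "j < 3" using cross_mat_carrier[of m] by auto
  show "(cross_mat m * proj_mat m) $$ (i, j) = cross_mat m $$ (i, j)"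
    unfolding mult_index3[OF cross_mat_carrier proj_mat_carrier ij]
    using ij unfolding less3
    by (elim disjE) (simp_all add: proj_mat_index cross_mat_index algebra_simps numeral_2_eq_2[symmetric])
qed (use proj_mat_carrier[of m] cross_mat_carrier[of m] in auto)

text \<open>The double product m x (m x a) = (m . a) m - a for a unit vector m.\<close>

lemma cross_cross: "cross_mat m * cross_mat m = - proj_mat m"
proof (rule eq_matI)
  fix i j assume "i < dim_row (- proj_mat m)" "j < dim_col (- proj_mat m)"
  hence ij: "i < 3" "j < 3" using proj_mat_carrier[of m] by auto
  have neg: "(- proj_mat m) $$ (i, j) = - (proj_mat m $$ (i, j))"
    using proj_mat_carrier[of m] ij by simp
  show "(cross_mat m * cross_mat m) $$ (i, j) = (- proj_mat m) $$ (i, j)"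
    unfolding neg mult_index3[OF cross_mat_carrier cross_mat_carrier ij]
    using ij comp3_norm unfolding less3
    by (elim disjE) (simp_all add: proj_mat_index cross_mat_index algebra_simps numeral_2_eq_2[symmetric])
qed (use proj_mat_carrier[of m] cross_mat_carrier[of m] in auto)

text \<open>If all diagonal entries 1 - m_q^2 vanished, |m|^2 would be 3.\<close>

lemma proj_mat_nonzero: "\<exists>q<3. proj_mat m $$ (q, q) \<noteq> 0"
proof (rule ccontr)
  assume "\<not> ?thesis"
  hence "\<And>q. q < 3 \<Longrightarrow> comp3 m q * comp3 m q = 1" by (auto simp: proj_mat_index)
  from this[of 0] this[of 1] this[of 2] comp3_norm show False by simp
qed

end

text \<open>The rows of \<open>B\<close> are orthonormal, so \<open>P\<close> is the orthogonal
  projector onto its kernel. The product of \<open>Z\<close> with its transpose fixes the columns of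
  \<open>P\<close>, and \<open>P\<close> fixes those of \<open>Z\<close>; both matrices are
  symmetric, so transposing the first relation identifies them.\<close>

lemma onb_columns_kernelD:
  assumes B: "B \<in> carrier_mat q n" and BB: "B * B\<^sup>T = 1\<^sub>m q"
    and Z: "onb_columns n r (mat_kernel B) Z"
  shows "Z * Z\<^sup>T = 1\<^sub>m n - B\<^sup>T * B"
proof -
  define P where "P = 1\<^sub>m n - B\<^sup>T * B"
  have Zc: "Z \<in> carrier_mat n r" and ZZ: "Z\<^sup>T * Z = 1\<^sub>m r"
    and cs: "vec_space.col_space n Z = mat_kernel B"
    using Z by (auto simp: onb_columns_def)
  have Pc: "P \<in> carrier_mat n n" using B by (auto simp: P_def)
  have BtB: "B\<^sup>T * B \<in> carrier_mat n n" using B by auto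
  have cs': "mat_kernel B = {y \<in> carrier_vec n. \<exists>x\<in>carrier_vec r. Z *\<^sub>v x = y}"
    using vec_space.col_space_eq[OF Zc] Zc cs by auto
  have PT: "P\<^sup>T = P" using B BtB by (simp add: P_def transpose_minus[of _ n n] transpose_mult[of _ n q])
  have BP: "B * P = 0\<^sub>m q n"
  proof -
    have "B * P = B - B * B\<^sup>T * B" unfolding P_def using B BtB by (simp add: mult_minus_distrib_mat[OF B _ BtB])
    thus ?thesis using B BB by simp
  qed
  have ZP: "Z * Z\<^sup>T * P = P"
  proof (rule mat_col_eqI)
    fix j assume "j < dim_col P"
    hence j: "j < n" using Pc by simp
    have "B *\<^sub>v col P j = col (B * P) j" using col_mult2[OF B Pc j] by simp
    hence "col P j \<in> mat_kernel B" using j Pc B by (intro mat_kernelI[OF B]) (auto simp: BP)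
    then obtain x where x: "x \<in> carrier_vec r" "Z *\<^sub>v x = col P j" using cs' by auto
    have "col (Z * Z\<^sup>T * P) j = Z * Z\<^sup>T *\<^sub>v (Z *\<^sub>v x)"
      using col_mult2[of "Z * Z\<^sup>T" n n P n j] Zc Pc j x by simp
    also have "\<dots> = Z *\<^sub>v ((Z\<^sup>T * Z) *\<^sub>v x)"
      using Zc x(1) assoc_mult_mat_vec[of Z n r "Z\<^sup>T" n "Z *\<^sub>v x"] by simp
    also have "\<dots> = col P j" using x by (simp add: ZZ)
    finally show "col (Z * Z\<^sup>T * P) j = col P j" .
  qed (use Zc Pc in auto)
  have BZ: "B * Z = 0\<^sub>m q r"
  proof (rule mat_col_eqI)
    fix j assume "j < dim_col (0\<^sub>m q r :: real mat)"
    hence j: "j < r" by simp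
    have "col Z j = Z *\<^sub>v unit_vec r j" using Zc j by (auto intro!: eq_vecI simp: scalar_prod_right_unit)
    hence "col Z j \<in> mat_kernel B" using cs' j Zc by auto
    thus "col (B * Z) j = col (0\<^sub>m q r) j"
      using mat_kernelD(2)[OF B] col_mult2[OF B Zc j] j by simp
  qed (use B Zc in auto)
  have "P * Z = Z - B\<^sup>T * (B * Z)"
    unfolding P_def using B Zc BtB by (simp add: minus_mult_distrib_mat[OF _ BtB Zc])
  hence "P * Z = Z - 0\<^sub>m n r" using B Zc by (simp add: BZ)
  hence PZ: "P * Z = Z" using Zc by (auto intro!: eq_matI)
  have "P * (Z * Z\<^sup>T) = (Z * Z\<^sup>T * P)\<^sup>T"
    using Zc Pc PT by (simp add: transpose_mult[of _ n n _ n] transpose_mult[of _ n r] del: assoc_mult_mat)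
  hence "P * Z * Z\<^sup>T = P" using Zc Pc PT ZP by simp
  thus ?thesis using PZ P_def by simp
qed

text \<open>The projector formula gives \<open>B * Z = 0\<close> after inserting the identity
  \<open>Z\<^sup>T * Z\<close>, and it represents every kernel vector y as \<open>Z\<close> applied
  to the coordinates \<open>Z\<^sup>T *\<^sub>v y\<close>.\<close>

lemma onb_columns_kernelI:
  assumes B: "B \<in> carrier_mat q n" and BB: "B * B\<^sup>T = 1\<^sub>m q"
    and Zc: "Z \<in> carrier_mat n r" and ZZ: "Z\<^sup>T * Z = 1\<^sub>m r" and P: "Z * Z\<^sup>T = 1\<^sub>m n - B\<^sup>T * B"
  shows "onb_columns n r (mat_kernel B) Z"
proof -
  have BtB: "B\<^sup>T * B \<in> carrier_mat n n" using B by auto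
  have "B * Z = B * (Z * (Z\<^sup>T * Z))" using Zc ZZ by simp
  also have "\<dots> = B * (Z * Z\<^sup>T * Z)" using Zc by (simp add: assoc_mult_mat[of Z n r _ n])
  also have "\<dots> = B * (Z * Z\<^sup>T) * Z" using B Zc assoc_mult_mat[of B q n "Z * Z\<^sup>T" n Z r] by simp
  also have "B * (Z * Z\<^sup>T) = B - B * B\<^sup>T * B"
    unfolding P using B BtB by (simp add: mult_minus_distrib_mat[OF B _ BtB])
  also have "\<dots> = 0\<^sub>m q n" using B BB by simp
  finally have BZ: "B * Z = 0\<^sub>m q r" using Zc by simp
  have "mat_kernel B = {y \<in> carrier_vec n. \<exists>x\<in>carrier_vec r. Z *\<^sub>v x = y}"
  proof (rule equalityI; rule subsetI)
    fix y assume y: "y \<in> mat_kernel B"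
    have yc: "y \<in> carrier_vec n" and By: "B *\<^sub>v y = 0\<^sub>v q" using mat_kernelD[OF B y] by auto
    have "Z *\<^sub>v (Z\<^sup>T *\<^sub>v y) = (Z * Z\<^sup>T) *\<^sub>v y" using Zc yc by simp
    also have "\<dots> = y - B\<^sup>T *\<^sub>v (B *\<^sub>v y)"
      unfolding P using B yc BtB by (simp add: minus_mult_distrib_mat_vec[OF _ BtB yc])
    also have "\<dots> = y" using By B yc by (auto intro!: eq_vecI)
    finally show "y \<in> {y \<in> carrier_vec n. \<exists>x\<in>carrier_vec r. Z *\<^sub>v x = y}"
      using yc Zc by (auto intro!: bexI[of _ "Z\<^sup>T *\<^sub>v y"])
  next
    fix y assume "y \<in> {y \<in> carrier_vec n. \<exists>x\<in>carrier_vec r. Z *\<^sub>v x = y}"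
    then obtain x where x: "x \<in> carrier_vec r" "y = Z *\<^sub>v x" by auto
    have "B *\<^sub>v y = (B * Z) *\<^sub>v x" using x B Zc by simp
    thus "y \<in> mat_kernel B" using x Zc BZ by (intro mat_kernelI[OF B]) auto
  qed
  thus ?thesis using vec_space.col_space_eq[OF Zc] Zc ZZ by (auto simp: onb_columns_def)
qed

lemma B_mat_const: "B_mat n (\<lambda>_. m) = kron (1\<^sub>m n) (row_mat m)"
  by (simp add: B_mat_def row_mat_def map_replicate_const diag_block_mat_replicate)

lemma S_mat_const: "S_mat n (\<lambda>_. m) = kron (1\<^sub>m n) (cross_mat m)"
  by (simp add: S_mat_def map_replicate_const diag_block_mat_replicate)

context
  fixes m :: "real^3" and n :: nat and B :: "real mat"
  assumes m: "norm m = 1"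
  defines "B \<equiv> B_mat n (\<lambda>_. m)"
begin

lemma B_mat_facts:
  "B \<in> carrier_mat n (3 * n)" "B * B\<^sup>T = 1\<^sub>m n" "1\<^sub>m (3 * n) - B\<^sup>T * B = kron (1\<^sub>m n) (proj_mat m)"
proof -
  note r = row_mat_carrier[of m]
  have rt: "(row_mat m)\<^sup>T \<in> carrier_mat 3 1" using r by simp
  show Bc: "B \<in> carrier_mat n (3 * n)"
    using kron_carrier[OF one_carrier_mat r, of n] by (simp add: B_def B_mat_const mult.commute)
  show "B * B\<^sup>T = 1\<^sub>m n"
    using kron_mult[OF one_carrier_mat r one_carrier_mat rt, of n] kron_one[of n 1]
    by (simp add: B_def B_mat_const kron_transpose row_mat_norm[OF m])
  have "B\<^sup>T * B = kron (1\<^sub>m n) ((row_mat m)\<^sup>T * row_mat m)"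
    using kron_mult[OF one_carrier_mat rt one_carrier_mat r, of n]
    by (simp add: B_def B_mat_const kron_transpose)
  thus "1\<^sub>m (3 * n) - B\<^sup>T * B = kron (1\<^sub>m n) (proj_mat m)"
    using kron_minus_right[OF one_carrier_mat one_carrier_mat, of "(row_mat m)\<^sup>T * row_mat m" 3 n]
      kron_one[of n 3, where ?'a = real] r rt by (simp add: proj_mat_def mult.commute)
qed

lemma tangent_basisD:
  assumes "tangent_basis n (\<lambda>_. m) Z"
  shows "Z \<in> carrier_mat (3 * n) (2 * n)" "Z\<^sup>T * Z = 1\<^sub>m (2 * n)" "Z * Z\<^sup>T = kron (1\<^sub>m n) (proj_mat m)"
  using assms onb_columns_kernelD[OF B_mat_facts(1,2)] B_mat_facts(3)
  by (auto simp: tangent_basis_def B_def onb_columns_def)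

lemma tangent_basisI:
  assumes "Z \<in> carrier_mat (3 * n) (2 * n)" "Z\<^sup>T * Z = 1\<^sub>m (2 * n)" "Z * Z\<^sup>T = kron (1\<^sub>m n) (proj_mat m)"
  shows "tangent_basis n (\<lambda>_. m) Z"
  using onb_columns_kernelI[OF B_mat_facts(1,2) assms(1,2)] assms(3) B_mat_facts(3)
  by (auto simp: tangent_basis_def B_def)

text \<open>A unit vector a orthogonal to m is completed by b = m x a to an orthonormal triple. The
  3 by 2 matrix with columns a and b is repeated at every node.\<close>

lemma ex_spatially_constant_basis:
  "\<exists>Z. tangent_basis n (\<lambda>_. m) Z \<and> spatially_constant_basis n m Z"
proof -
  obtain a' :: "real^3" where a': "a' \<noteq> 0" "Linear_Algebra.orthogonal m a'"
    using orthogonal_to_vector_exists[of m] by auto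
  define a where "a = a' /\<^sub>R norm a'"
  have aa: "inner a a = 1" and ma: "inner m a = 0"
    using a' by (auto simp: a_def Linear_Algebra.orthogonal_def dot_square_norm power2_eq_square field_simps)
  define b where "b = cross3 m a"
  have mm: "inner m m = 1" using m by (simp add: norm_eq_1)
  have mb: "inner m b = 0" and ab: "inner a b = 0" by (auto simp: b_def dot_cross_self)
  \<comment> \<open>Lagrange's identity |m x a|^2 + (m . a)^2 = |m|^2 |a|^2.\<close>
  have bb: "inner b b = 1"
    using norm_cross_dot[of m a] m aa ma by (simp add: b_def dot_square_norm)
  define R where "R = mat_of_rows 3 [vec_of_R3 m, vec_of_R3 a, vec_of_R3 b]"
  have Rc: "R \<in> carrier_mat 3 3" by (auto simp: R_def)
  have Rr: "Matrix.row R 0 = vec_of_R3 m" "Matrix.row R 1 = vec_of_R3 a" "Matrix.row R 2 = vec_of_R3 b"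
    by (auto simp: R_def vec_of_R3_carrier)
  have "R * R\<^sup>T = 1\<^sub>m 3"
    using Rc Rr mm aa bb ma mb ab inner_commute[of m a] inner_commute[of m b] inner_commute[of a b]
    by (intro eq_matI) (auto simp: less3 scalar_prod_vec_of_R3)
  \<comment> \<open>Orthonormal rows of a square matrix give orthonormal columns. Entrywise this is
    the completeness relation of the triple, from which the projection onto the plane of a and b is
    read off.\<close>
  hence RR: "R\<^sup>T * R = 1\<^sub>m 3" using mat_mult_left_right_inverse[OF Rc _ \<open>R * R\<^sup>T = 1\<^sub>m 3\<close>] Rc by simp
  have Ri: "R $$ (0, j) = comp3 m j" "R $$ (1, j) = comp3 a j" "R $$ (2, j) = comp3 b j" if "j < 3" for j
    using that by (auto simp: R_def mat_of_rows_index vec_of_R3_index)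
  have res: "comp3 m i * comp3 m j + comp3 a i * comp3 a j + comp3 b i * comp3 b j = (if i = j then 1 else 0)"
    if "i < 3" "j < 3" for i j
    using arg_cong[OF RR, of "\<lambda>M. M $$ (i, j)"] that Rc Ri by (simp add: scalar_prod_def sum3)
  define W where "W = mat_of_cols 3 [vec_of_R3 a, vec_of_R3 b]"
  have Wc: "W \<in> carrier_mat 3 2" by (auto simp: W_def)
  have Wcol: "col W 0 = vec_of_R3 a" "col W 1 = vec_of_R3 b" by (auto simp: W_def vec_of_R3_carrier)
  have less2: "i < 2 \<longleftrightarrow> i = 0 \<or> i = 1" for i :: nat by auto
  have WW: "W\<^sup>T * W = 1\<^sub>m 2"
    using Wc Wcol aa bb ab inner_commute[of a b]
    by (intro eq_matI) (auto simp: less2 scalar_prod_vec_of_R3)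
  have Wi: "W $$ (j, 0) = comp3 a j" "W $$ (j, 1) = comp3 b j" if "j < 3" for j
    using that by (auto simp: W_def mat_of_cols_index vec_of_R3_index)
  have WWt: "W * W\<^sup>T = proj_mat m"
  proof (rule eq_matI)
    fix i j assume "i < dim_row (proj_mat m)" "j < dim_col (proj_mat m)"
    hence ij: "i < 3" "j < 3" using proj_mat_carrier[of m] by auto
    have "(W * W\<^sup>T) $$ (i, j) = comp3 a i * comp3 a j + comp3 b i * comp3 b j"
      using ij Wc Wi by (simp add: scalar_prod_def numeral_2_eq_2)
    thus "(W * W\<^sup>T) $$ (i, j) = proj_mat m $$ (i, j)"
      using res[OF ij] proj_mat_index[OF ij, of m] by linarith
  qed (use Wc proj_mat_carrier[of m] in auto)
  have W: "onb_columns 3 2 (vec_of_R3 ` {a. inner m a = 0}) W"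
    unfolding kernel_row_mat[symmetric]
    using onb_columns_kernelI[OF row_mat_carrier row_mat_norm[OF m] Wc WW] WWt by (simp add: proj_mat_def)
  define Z where "Z = kron (1\<^sub>m n) W"
  have Wt: "W\<^sup>T \<in> carrier_mat 2 3" using Wc by simp
  have "tangent_basis n (\<lambda>_. m) Z"
  proof (rule tangent_basisI)
    show "Z \<in> carrier_mat (3 * n) (2 * n)"
      using kron_carrier[OF one_carrier_mat Wc, of n] by (simp add: Z_def mult.commute)
    show "Z\<^sup>T * Z = 1\<^sub>m (2 * n)"
      using kron_mult[OF one_carrier_mat Wt one_carrier_mat Wc, of n] kron_one[of n 2, where ?'a = real]
      by (simp add: Z_def kron_transpose WW mult.commute)
    show "Z * Z\<^sup>T = kron (1\<^sub>m n) (proj_mat m)"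
      using kron_mult[OF one_carrier_mat Wc one_carrier_mat Wt, of n]
      by (simp add: Z_def kron_transpose WWt)
  qed
  moreover have "spatially_constant_basis n m Z"
    unfolding spatially_constant_basis_def Z_def diag_block_mat_replicate[symmetric] using W by blast
  ultimately show ?thesis by blast
qed

end

section \<open>Compression to the tangent space\<close>

text \<open>Stated over a commutative ring because it is used twice, for the real \<open>Z\<close>
  and for \<open>complex_mat Z\<close>. The entries of the latter are real, so the plain transpose
  also serves in the complex case.\<close>

locale orthonormal_frame =
  fixes n k :: nat and Z :: "'a::comm_ring_1 mat" and p :: "'a mat"
  assumes Z: "Z \<in> carrier_mat (n * 3) k" and p: "p \<in> carrier_mat 3 3"
    and ZZ: "Z\<^sup>T * Z = 1\<^sub>m k" and ZZt: "Z * Z\<^sup>T = kron (1\<^sub>m n) p"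
begin

definition "compress A X = Z\<^sup>T * kron A X * Z"

lemma compress_carrier:
  assumes "A \<in> carrier_mat n n" "X \<in> carrier_mat 3 3"
  shows "compress A X \<in> carrier_mat k k"
  using Z kron_carrier[OF assms] unfolding compress_def by auto

text \<open>Between the two compressions \<open>Z\<close> meets its transpose, which leaves the
  identity tensor \<open>p\<close>; this merges into the second Kronecker factors. Compression is
  thus multiplicative whenever the inserted \<open>p\<close> can be absorbed.\<close>

lemma compress_mult:
  assumes A: "A \<in> carrier_mat n n" and B: "B \<in> carrier_mat n n"
    and X: "X \<in> carrier_mat 3 3" and Y: "Y \<in> carrier_mat 3 3"
  shows "compress A X * compress B Y = compress (A * B) (X * p * Y)"
proof -
  let ?U = "kron A X" and ?V = "kron B Y"
  note U = kron_carrier[OF A X] and V = kron_carrier[OF B Y]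
  have Zt: "Z\<^sup>T \<in> carrier_mat k (n * 3)" using Z by simp
  have Xp: "X * p \<in> carrier_mat 3 3" using X p by simp
  have ZV: "?V * Z \<in> carrier_mat (n * 3) k" using V Z by simp
  have "compress A X * compress B Y = Z\<^sup>T * ?U * Z * (Z\<^sup>T * (?V * Z))"
    unfolding compress_def using assoc_mult_mat[OF Zt V Z] by simp
  also have "\<dots> = Z\<^sup>T * ?U * (Z * (Z\<^sup>T * (?V * Z)))"
    using Zt U Z ZV by (intro assoc_mult_mat[of _ k "n * 3" _ k _ k]) auto
  also have "Z * (Z\<^sup>T * (?V * Z)) = kron (1\<^sub>m n) p * (?V * Z)"
    using assoc_mult_mat[OF Z Zt ZV] ZZt by simp
  also have "\<dots> = kron B (p * Y) * Z"
    using assoc_mult_mat[OF kron_carrier[OF one_carrier_mat p, of n] V Z]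
      kron_mult[OF one_carrier_mat p B Y] B by simp
  also have "Z\<^sup>T * ?U * (kron B (p * Y) * Z) = Z\<^sup>T * (?U * kron B (p * Y)) * Z"
    using assoc_mult_mat[OF Zt U kron_carrier[OF B, of "p * Y" 3 3]] p Y Z Zt U
      assoc_mult_mat[of "Z\<^sup>T * ?U" k "n * 3" "kron B (p * Y)" "n * 3" Z k]
      kron_carrier[OF B, of "p * Y" 3 3]
    by (simp add: mult_carrier_mat[of _ k "n * 3"])
  also have "?U * kron B (p * Y) = kron (A * B) (X * p * Y)"
    using kron_mult[OF A X B, of "p * Y" 3] p X Y by simp
  finally show ?thesis by (simp add: compress_def)
qed

text \<open>The transpose of \<open>Z\<close> already absorbs \<open>p\<close>, as
  \<open>Z\<^sup>T * Z = 1\<close>.\<close>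

lemma compress_proj_left:
  assumes A: "A \<in> carrier_mat n n" and X: "X \<in> carrier_mat 3 3"
  shows "compress A (p * X) = compress A X"
proof -
  note U = kron_carrier[OF A X] and q = kron_carrier[OF one_carrier_mat p, of n]
  have Zt: "Z\<^sup>T \<in> carrier_mat k (n * 3)" using Z by simp
  have "Z\<^sup>T * kron (1\<^sub>m n) p = Z\<^sup>T * Z * Z\<^sup>T"
    unfolding ZZt[symmetric] by (rule assoc_mult_mat[OF Zt Z Zt, symmetric])
  hence zt: "Z\<^sup>T * kron (1\<^sub>m n) p = Z\<^sup>T" using Zt by (simp add: ZZ)
  have "kron A (p * X) = kron (1\<^sub>m n) p * kron A X"
    using kron_mult[OF one_carrier_mat p A X] A by simp
  hence "Z\<^sup>T * kron A (p * X) = Z\<^sup>T * kron A X"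
    using assoc_mult_mat[OF Zt q U] zt by simp
  thus ?thesis by (simp add: compress_def)
qed

lemma compress_smult:
  assumes A: "A \<in> carrier_mat n n" and X: "X \<in> carrier_mat 3 3"
  shows "compress (c \<cdot>\<^sub>m A) X = c \<cdot>\<^sub>m compress A X"
  using kron_carrier[OF A X] Z mult_smult_distrib[of "Z\<^sup>T" k "n * 3" "kron A X" "n * 3" c]
    mult_smult_assoc_mat[of "Z\<^sup>T * kron A X" k "n * 3" Z k c]
  by (simp add: compress_def kron_smult_left)

lemma compress_one: "compress (1\<^sub>m n) (1\<^sub>m 3) = 1\<^sub>m k"
  using Z by (simp add: compress_def kron_one ZZ)

text \<open>As \<open>kron A (1\<^sub>m 3)\<close> commutes with the projector, it preserves the
  tangent space. The first identity moves vectors back to the full grid space; the second serves to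
  show that a compression does not vanish.\<close>

lemma lift_compress:
  assumes A: "A \<in> carrier_mat n n"
  shows "Z * compress A (1\<^sub>m 3) = kron A (1\<^sub>m 3) * Z"
    and "Z * compress A (1\<^sub>m 3) * Z\<^sup>T = kron A p"
proof -
  note U = kron_carrier[OF A one_carrier_mat, of 3] and q = kron_carrier[OF one_carrier_mat p, of n]
  have Zt: "Z\<^sup>T \<in> carrier_mat k (n * 3)" using Z by simp
  have UZ: "kron A (1\<^sub>m 3) * Z \<in> carrier_mat (n * 3) k" using U Z by simp
  have qZ: "kron (1\<^sub>m n) p * Z = Z"
    using assoc_mult_mat[OF Z Zt Z] Z by (simp add: ZZt ZZ)
  have c: "kron (1\<^sub>m n) p * kron A (1\<^sub>m 3) = kron A (1\<^sub>m 3) * kron (1\<^sub>m n) p"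
    using kron_mult[OF one_carrier_mat p A one_carrier_mat]
      kron_mult[OF A one_carrier_mat one_carrier_mat p] A p by simp
  have "Z * compress A (1\<^sub>m 3) = Z * (Z\<^sup>T * (kron A (1\<^sub>m 3) * Z))"
    unfolding compress_def using assoc_mult_mat[OF Zt U Z] by simp
  also have "\<dots> = kron (1\<^sub>m n) p * (kron A (1\<^sub>m 3) * Z)"
    using assoc_mult_mat[OF Z Zt UZ] ZZt by simp
  also have "\<dots> = kron A (1\<^sub>m 3) * (kron (1\<^sub>m n) p * Z)"
    using assoc_mult_mat[OF q U Z] assoc_mult_mat[OF U q Z] c by simp
  finally show 1: "Z * compress A (1\<^sub>m 3) = kron A (1\<^sub>m 3) * Z" using qZ by simp
  have "kron A (1\<^sub>m 3) * Z * Z\<^sup>T = kron A (1\<^sub>m 3) * kron (1\<^sub>m n) p"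
    using assoc_mult_mat[OF U Z Zt] ZZt by simp
  thus "Z * compress A (1\<^sub>m 3) * Z\<^sup>T = kron A p"
    unfolding 1 using kron_mult[OF A one_carrier_mat one_carrier_mat p] A p by simp
qed

end

text \<open>Transfers spectral data from scalar grid functions to the tangent space. The projections
  \<Phi> act on nodes only, so their compressions commute with that of the cross product;
  completeness of the family gives the trivial joint kernel.\<close>

lemma tangent_pair_compression:
  fixes A :: "real mat" and \<Phi> :: "'x \<Rightarrow> complex mat" and b :: "'x \<Rightarrow> real"
  assumes m: "norm m = 1" and tb: "tangent_basis n (\<lambda>_. m) Z"
    and A: "A \<in> carrier_mat n n" and At: "A\<^sup>T = A" and n: "n > 0"
    and \<Phi>: "\<And>x. x \<in> X \<Longrightarrow> \<Phi> x \<in> carrier_mat n n"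
    and e: "\<And>x. x \<in> X \<Longrightarrow> eigenmat (complex_mat A) (\<Phi> x) (of_real (b x))"
    and nz: "\<And>x. x \<in> X \<Longrightarrow> \<Phi> x $$ (0, 0) \<noteq> 0"
    and sum: "\<And>r s. r < n \<Longrightarrow> s < n \<Longrightarrow> (\<Sum>x\<in>X. \<Phi> x $$ (r, s)) = (if r = s then 1 else 0)"
    and b: "\<And>x. x \<in> X \<Longrightarrow> b x > 0"
  shows "tangent_pair (2 * n) (tangent_reduce Z (componentwise A)) (tangent_reduce Z (S_mat n (\<lambda>_. m)))
    X (\<lambda>x. (complex_mat Z)\<^sup>T * kron (\<Phi> x) (1\<^sub>m 3) * complex_mat Z) b"
proof -
  let ?p = "proj_mat m" and ?C = "cross_mat m" and ?Zc = "complex_mat Z"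
  note Z = tangent_basisD[OF m tb]
  note p = proj_mat_carrier[of m] and C = cross_mat_carrier[of m]
  interpret R: orthonormal_frame n "2 * n" Z ?p
    using Z p by unfold_locales (auto simp: mult.commute)
  have Zt: "Z\<^sup>T \<in> carrier_mat (2 * n) (3 * n)" using Z by simp
  interpret D: orthonormal_frame n "2 * n" ?Zc "complex_mat ?p"
  proof
    show "?Zc \<in> carrier_mat (n * 3) (2 * n)" using Z(1) by (simp add: mult.commute)
    show "complex_mat ?p \<in> carrier_mat 3 3" using p by simp
    show "?Zc\<^sup>T * ?Zc = 1\<^sub>m (2 * n)"
      using of_real_hom.mat_hom_mult[OF Zt Z(1), where ?'a = complex] Z(2)
      by (simp add: map_mat_transpose of_real_hom.mat_hom_one)
    have "complex_mat (1\<^sub>m n) = 1\<^sub>m n" by (rule of_real_hom.mat_hom_one)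
    thus "?Zc * ?Zc\<^sup>T = kron (1\<^sub>m n) (complex_mat ?p)"
      using of_real_hom.mat_hom_mult[OF Z(1) Zt, where ?'a = complex] Z(3)
      by (simp add: map_mat_transpose complex_mat_kron)
  qed
  have HT: "tangent_reduce Z (componentwise A) = R.compress A (1\<^sub>m 3)"
    by (simp add: tangent_reduce_def componentwise_eq_kron R.compress_def)
  have ST: "tangent_reduce Z (S_mat n (\<lambda>_. m)) = R.compress (1\<^sub>m n) ?C"
    by (simp add: tangent_reduce_def S_mat_const R.compress_def)
  have cx: "complex_mat (R.compress B Y) = D.compress (complex_mat B) (complex_mat Y)"
    if "B \<in> carrier_mat n n" "Y \<in> carrier_mat 3 3" for B Y
  proof -
    have k: "kron B Y \<in> carrier_mat (3 * n) (3 * n)" using kron_carrier[OF that] by (simp add: mult.commute)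
    have k2: "Z\<^sup>T * kron B Y \<in> carrier_mat (2 * n) (3 * n)" using Zt k by (rule mult_carrier_mat)
    show ?thesis unfolding R.compress_def D.compress_def
      by (simp only: of_real_hom.mat_hom_mult[OF k2 Z(1)] of_real_hom.mat_hom_mult[OF Zt k]
          map_mat_transpose complex_mat_kron)
  qed
  have tr: "(R.compress B Y)\<^sup>T = R.compress B\<^sup>T Y\<^sup>T"
    if "B \<in> carrier_mat n n" "Y \<in> carrier_mat 3 3" for B Y
  proof -
    have k: "kron B Y \<in> carrier_mat (3 * n) (3 * n)" using kron_carrier[OF that] by (simp add: mult.commute)
    have k2: "Z\<^sup>T * kron B Y \<in> carrier_mat (2 * n) (3 * n)" using Zt k by (rule mult_carrier_mat)
    have "(kron B Y)\<^sup>T \<in> carrier_mat (3 * n) (3 * n)" using k by simp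
    thus ?thesis unfolding R.compress_def transpose_mult[OF k2 Z(1)] transpose_mult[OF Zt k] kron_transpose
      using Z(1) Zt by (simp add: assoc_mult_mat[of _ "2 * n" "3 * n" _ "3 * n" _ "2 * n"])
  qed
  have c1: "complex_mat (1\<^sub>m j) = 1\<^sub>m j" for j by (rule of_real_hom.mat_hom_one)
  have pC: "complex_mat ?p * complex_mat ?C = complex_mat ?C"
    "complex_mat ?C * complex_mat ?p = complex_mat ?C"
    using of_real_hom.mat_hom_mult[OF p C, where ?'a = complex] proj_cross[OF m]
      of_real_hom.mat_hom_mult[OF C p, where ?'a = complex] cross_proj[OF m] by simp_all
  have pc: "complex_mat ?p \<in> carrier_mat 3 3" and Cc: "complex_mat ?C \<in> carrier_mat 3 3"
    and Ac: "complex_mat A \<in> carrier_mat n n" using p C A by auto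
  show ?thesis unfolding HT ST D.compress_def[symmetric]
  proof
    show "R.compress A (1\<^sub>m 3) \<in> carrier_mat (2 * n) (2 * n)" "R.compress (1\<^sub>m n) ?C \<in> carrier_mat (2 * n) (2 * n)"
      using R.compress_carrier A C by auto
    \<comment> \<open>Both products are the compression of \<open>A\<close> and the cross matrix,
      because the latter absorbs \<open>p\<close> on either side.\<close>
    show "R.compress A (1\<^sub>m 3) * R.compress (1\<^sub>m n) ?C = R.compress (1\<^sub>m n) ?C * R.compress A (1\<^sub>m 3)"
      using R.compress_mult[OF A one_carrier_mat one_carrier_mat C]
        R.compress_mult[OF one_carrier_mat A C one_carrier_mat] A p C proj_cross[OF m] cross_proj[OF m]
      by simp
    have "R.compress (1\<^sub>m n) (- ?p) = - R.compress (1\<^sub>m n) ?p"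
      using Z(1) Zt kron_carrier[OF one_carrier_mat p, of n] by (simp add: R.compress_def kron_uminus_right)
    moreover have "R.compress (1\<^sub>m n) ?p = R.compress (1\<^sub>m n) (1\<^sub>m 3)"
      using R.compress_proj_left[OF one_carrier_mat one_carrier_mat] p by simp
    \<comment> \<open>The square compresses C p C = C C = - p, and \<open>p\<close> next to the
      transposed basis acts as the identity.\<close>
    ultimately show "R.compress (1\<^sub>m n) ?C * R.compress (1\<^sub>m n) ?C = - 1\<^sub>m (2 * n)"
      using R.compress_mult[OF one_carrier_mat one_carrier_mat C C] cross_proj[OF m] cross_cross[OF m] R.compress_one
      by simp
    show "(R.compress (1\<^sub>m n) ?C)\<^sup>T = - R.compress (1\<^sub>m n) ?C"
      unfolding tr[OF one_carrier_mat C] using Z(1) Zt kron_carrier[OF one_carrier_mat C, of n]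
      by (simp add: cross_mat_transpose R.compress_def kron_uminus_right)
    show "(R.compress A (1\<^sub>m 3))\<^sup>T = R.compress A (1\<^sub>m 3)" unfolding tr[OF A one_carrier_mat] by (simp add: At)
    fix x assume x: "x \<in> X"
    note F = \<Phi>[OF x]
    show "D.compress (\<Phi> x) (1\<^sub>m 3) \<in> carrier_mat (2 * n) (2 * n)" using D.compress_carrier[OF F] by simp
    have "D.compress (\<Phi> x) (complex_mat ?p) = D.compress (\<Phi> x) (1\<^sub>m 3)"
      using D.compress_proj_left[OF F one_carrier_mat] pc by simp
    thus "eigenmat (complex_mat (R.compress A (1\<^sub>m 3))) (D.compress (\<Phi> x) (1\<^sub>m 3)) (of_real (b x))"
      using e[OF x] D.compress_mult[OF Ac F one_carrier_mat one_carrier_mat] pc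
        D.compress_mult[OF F Ac one_carrier_mat one_carrier_mat] D.compress_smult[OF F pc]
      by (simp add: eigenmat_def cx[OF A] c1)
    show "D.compress (\<Phi> x) (1\<^sub>m 3) * complex_mat (R.compress (1\<^sub>m n) ?C)
        = complex_mat (R.compress (1\<^sub>m n) ?C) * D.compress (\<Phi> x) (1\<^sub>m 3)"
      using D.compress_mult[OF F one_carrier_mat one_carrier_mat Cc]
        D.compress_mult[OF one_carrier_mat F Cc one_carrier_mat] F pc Cc
      by (simp add: cx[OF one_carrier_mat C] c1 pC)
    show "D.compress (\<Phi> x) (1\<^sub>m 3) \<noteq> 0\<^sub>m (2 * n) (2 * n)"
    proof
      assume z: "D.compress (\<Phi> x) (1\<^sub>m 3) = 0\<^sub>m (2 * n) (2 * n)"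
      \<comment> \<open>Lifting a vanishing compression gives a vanishing Kronecker product of
        \<open>\<Phi> x\<close> with \<open>p\<close>. As q < 3, its entry (q, q) lies in the block
        of node 0 and equals \<Phi> x (0, 0) times p (q, q).\<close>
      obtain q where q: "q < 3" "?p $$ (q, q) \<noteq> 0" using proj_mat_nonzero[OF m] by blast
      have "kron (\<Phi> x) (complex_mat ?p) = 0\<^sub>m (n * 3) (n * 3)"
        using D.lift_compress(2)[OF F] Z(1) by (simp add: z mult.commute)
      hence "kron (\<Phi> x) (complex_mat ?p) $$ (q, q) = 0" using q n by simp
      moreover have "kron (\<Phi> x) (complex_mat ?p) $$ (q, q) = \<Phi> x $$ (0, 0) * of_real (?p $$ (q, q))"
        using q n p kron_index[OF F pc, of q q] by simp
      ultimately show False using nz[OF x] q by simp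
    qed
    show "b x > 0" by (rule b[OF x])
  next
    fix v :: "complex Matrix.vec"
    assume v: "v \<in> carrier_vec (2 * n)" and 0: "\<forall>x\<in>X. D.compress (\<Phi> x) (1\<^sub>m 3) *\<^sub>v v = 0\<^sub>v (2 * n)"
    define w where "w = ?Zc *\<^sub>v v"
    have Zc: "?Zc \<in> carrier_mat (n * 3) (2 * n)" by (rule D.Z)
    have w: "w \<in> carrier_vec (n * 3)" using Zc v by (simp add: w_def)
    have kw: "kron (\<Phi> x) (1\<^sub>m 3) *\<^sub>v w = 0\<^sub>v (n * 3)" if x: "x \<in> X" for x
    proof -
      note F = \<Phi>[OF x]
      have "kron (\<Phi> x) (1\<^sub>m 3) *\<^sub>v w = (kron (\<Phi> x) (1\<^sub>m 3) * ?Zc) *\<^sub>v v"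
        unfolding w_def by (rule assoc_mult_mat_vec[OF kron_carrier[OF F one_carrier_mat] Zc v, symmetric])
      also have "\<dots> = ?Zc *\<^sub>v (D.compress (\<Phi> x) (1\<^sub>m 3) *\<^sub>v v)"
        unfolding D.lift_compress(1)[OF F, symmetric]
        using D.compress_carrier[OF F one_carrier_mat] Zc v by simp
      also have "\<dots> = 0\<^sub>v (n * 3)" using 0 x Zc by auto
      finally show ?thesis .
    qed
    have "w = 0\<^sub>v (n * 3)"
    proof (rule eq_vecI)
      fix i assume "i < dim_vec (0\<^sub>v (n * 3) :: complex Matrix.vec)"
      hence i: "i < n * 3" by simp
      have s: "(\<Sum>x\<in>X. kron (\<Phi> x) (1\<^sub>m 3) $$ (i, j)) = (if i = j then 1 else 0)" if j: "j < n * 3" for j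
      proof -
        have "(\<Sum>x\<in>X. kron (\<Phi> x) (1\<^sub>m 3) $$ (i, j))
            = (\<Sum>x\<in>X. \<Phi> x $$ (i div 3, j div 3)) * (1\<^sub>m 3 :: complex mat) $$ (i mod 3, j mod 3)"
          unfolding sum_distrib_right
          by (rule sum.cong) (use kron_index[OF \<Phi> one_carrier_mat i j] in auto)
        also have "\<dots> = kron (1\<^sub>m n) (1\<^sub>m 3) $$ (i, j)"
          unfolding kron_index[OF one_carrier_mat one_carrier_mat i j]
          using sum div_mod_bounds[OF i] div_mod_bounds[OF j] by simp
        finally show ?thesis using i j by (simp add: kron_one)
      qed
      \<comment> \<open>The Kronecker delta is replaced by the sum of all lifted projections, each
        of which annihilates \<open>w\<close>.\<close>
      have "vec_index w i = (\<Sum>j = 0..<n * 3. (\<Sum>x\<in>X. kron (\<Phi> x) (1\<^sub>m 3) $$ (i, j)) * vec_index w j)"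
        using i by (simp add: s if_distrib[of "\<lambda>t. t * _"] cong: if_cong)
      also have "\<dots> = (\<Sum>x\<in>X. \<Sum>j = 0..<n * 3. kron (\<Phi> x) (1\<^sub>m 3) $$ (i, j) * vec_index w j)"
        unfolding sum_distrib_right by (rule sum.swap)
      also have "\<dots> = (\<Sum>x\<in>X. vec_index (kron (\<Phi> x) (1\<^sub>m 3) *\<^sub>v w) i)"
      proof (rule sum.cong[OF refl])
        fix x assume "x \<in> X"
        note k = kron_carrier[OF \<Phi>[OF this] one_carrier_mat, of 3]
        show "(\<Sum>j = 0..<n * 3. kron (\<Phi> x) (1\<^sub>m 3) $$ (i, j) * vec_index w j)
            = vec_index (kron (\<Phi> x) (1\<^sub>m 3) *\<^sub>v w) i"
          using k i w by (simp add: scalar_prod_def)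
      qed
      also have "\<dots> = 0" using kw i by simp
      finally show "vec_index w i = vec_index (0\<^sub>v (n * 3)) i" using i by simp
    qed (use w in auto)
    moreover have "v = ?Zc\<^sup>T *\<^sub>v w"
      unfolding w_def using Zc v assoc_mult_mat_vec[of "?Zc\<^sup>T" "2 * n" "n * 3" ?Zc "2 * n" v] D.ZZ by simp
    ultimately show "v = 0\<^sub>v (2 * n)" using Zc by auto
  qed
qed

section \<open>Discrete Fourier projections\<close>

text \<open>A geometric sum over an n-th root of unity, which is trivial exactly when n divides
  a.\<close>

lemma sum_cis_roots:
  assumes n: "n > 0"
  shows "(\<Sum>j<n. cis (2 * pi * of_int a * real j / real n)) = (if int n dvd a then of_nat n else 0)"
proof -
  define z where "z = cis (2 * pi * of_int a / real n)"
  have p: "cis (2 * pi * of_int a * real j / real n) = z ^ j" for j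
    by (simp add: z_def DeMoivre mult_ac)
  have zn: "z ^ n = 1" using n by (simp add: z_def DeMoivre)
  have "z = 1 \<longleftrightarrow> int n dvd a"
  proof
    assume "z = 1"
    hence "cos (2 * pi * of_int a / real n) = 1" by (simp add: z_def complex_eq_iff)
    then obtain q :: int where q: "2 * pi * of_int a / real n = of_int q * 2 * pi"
      by (subst (asm) cos_one_2pi_int) blast
    hence "(of_int a :: real) = of_int (q * int n)" using n by (simp add: field_simps)
    hence "a = q * int n" by (simp only: of_int_eq_iff)
    thus "int n dvd a" by simp
  next
    assume "int n dvd a"
    then obtain q where "a = int n * q" by blast
    hence "2 * pi * of_int a / real n = 2 * pi * of_int q" using n by simp
    thus "z = 1" by (simp only: z_def cis_multiple_2pi[OF Ints_of_int])
  qed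
  thus ?thesis unfolding p using zn by (auto simp: geometric_sum)
qed

lemma centred_repsD:
  assumes "centred_reps n K" "n > 0"
  shows "finite K" "bij_betw (\<lambda>k. k mod int n) K {0..<int n}"
proof -
  from assms show fin: "finite K"
    by (auto simp: centred_reps_def intro: card_ge_0_finite)
  have i: "inj_on (\<lambda>k. k mod int n) K" and c: "card K = n" using assms by (auto simp: centred_reps_def)
  have "(\<lambda>k. k mod int n) ` K = {0..<int n}"
    by (rule card_subset_eq) (use assms(2) in \<open>auto simp: card_image[OF i] c\<close>)
  thus "bij_betw (\<lambda>k. k mod int n) K {0..<int n}" using i by (simp add: bij_betw_def)
qed

lemma centred_reps_obtain:
  assumes "centred_reps n K" "n > 0"
  obtains k where "k \<in> K" "k mod int n = a mod int n"
proof -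
  have "a mod int n \<in> (\<lambda>k. k mod int n) ` K"
    using centred_repsD(2)[OF assms] assms(2) by (simp add: bij_betw_def)
  thus ?thesis using that by (auto simp: image_iff)
qed

text \<open>Supplies the constant mode, where the eigenvalue \<alpha> is attained.\<close>

lemma centred_reps_zero:
  assumes "centred_reps n K" "n > 0"
  shows "0 \<in> K"
proof -
  obtain k where k: "k \<in> K" "k mod int n = 0 mod int n" using centred_reps_obtain[OF assms] .
  then obtain q where q: "k = int n * q" by auto
  have "2 * \<bar>k\<bar> \<le> int n" using k assms by (auto simp: centred_reps_def)
  hence "int n * (2 * \<bar>q\<bar>) \<le> int n * 1" unfolding q by (simp add: abs_mult)
  hence "2 * \<bar>q\<bar> \<le> 1" using assms(2) by (subst (asm) mult_le_cancel_left_pos) auto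
  hence "q = 0" by linarith
  thus ?thesis using k q by simp
qed

text \<open>Supplies a highest frequency in each direction, whichever centred set is chosen.\<close>

lemma centred_reps_half:
  assumes "centred_reps n K" "n > 0"
  shows "\<exists>k\<in>K. \<bar>k\<bar> = int (n div 2)"
proof -
  obtain k where k: "k \<in> K" "k mod int n = int (n div 2) mod int n" using centred_reps_obtain[OF assms] .
  have b: "2 * \<bar>k\<bar> \<le> int n" using k assms by (auto simp: centred_reps_def)
  from k(2) have "int n dvd k - int (n div 2)" by (simp add: mod_eq_dvd_iff)
  then obtain q where q: "k - int (n div 2) = int n * q" by blast
  have h: "2 * int (n div 2) \<le> int n" by simp
  have "\<bar>int n * q\<bar> \<le> int n" using b h unfolding q[symmetric] by linarith
  hence "\<bar>q\<bar> \<le> 1" using assms(2) by (simp add: abs_mult)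
  \<comment> \<open>The value q = 1 violates the bound on k, and q = -1 is possible only for even n,
    where it gives k = - n / 2.\<close>
  hence "q = 0 \<or> q = 1 \<or> q = -1" by linarith
  moreover have "0 \<le> int (n div 2)" by simp
  ultimately have "\<bar>k\<bar> = int (n div 2)" using q b h by auto
  thus ?thesis using k by blast
qed

text \<open>The summand has period n in k, so any set of representatives may be exchanged for 0,
  ..., n - 1.\<close>

lemma sum_cis_reps:
  assumes K: "centred_reps n K" and n: "n > 0"
  shows "(\<Sum>k\<in>K. cis (2 * pi * of_int a * of_int k / real n)) = (if int n dvd a then of_nat n else 0)"
proof -
  define g where "g = (\<lambda>k::int. cis (2 * pi * of_int a * of_int k / real n))"
  have per: "g k = g (k mod int n)" for k
  proof -
    have "2 * pi * of_int a * of_int k / real n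
        = 2 * pi * of_int a * of_int (k mod int n) / real n + 2 * pi * of_int (a * (k div int n))"
    proof -
      have "(of_int k :: real) = of_int (int n * (k div int n) + k mod int n)" by simp
      hence k: "(of_int k :: real) = real n * of_int (k div int n) + of_int (k mod int n)"
        unfolding of_int_add of_int_mult by simp
      show ?thesis unfolding k using n by (simp add: field_simps)
    qed
    thus ?thesis by (simp only: g_def cis_mult[symmetric] cis_multiple_2pi[OF Ints_of_int] mult_1_right)
  qed
  have "(\<Sum>k\<in>K. g k) = (\<Sum>k\<in>K. g (k mod int n))" by (rule sum.cong[OF refl]) (rule per)
  also have "\<dots> = (\<Sum>k\<in>{0..<int n}. g k)"
    by (rule sum.reindex_bij_betw[OF centred_repsD(2)[OF K n]])
  also have "\<dots> = (\<Sum>j<n. g (int j))"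
    by (rule sum.reindex_bij_betw[symmetric])
      (rule bij_betwI[of _ _ _ nat], auto)
  also have "\<dots> = (if int n dvd a then of_nat n else 0)"
    using sum_cis_roots[OF n] by (simp add: g_def)
  finally show ?thesis by (simp add: g_def)
qed

lemma cis_sum: "cis (\<Sum>l\<in>A. f l) = (\<Prod>l\<in>A. cis (f l))"
  by (induction A rule: infinite_finite_induct) (auto simp: cis_mult[symmetric])

locale fourier_grid =
  fixes d :: nat and L :: "nat \<Rightarrow> real" and K :: "nat \<Rightarrow> int set" and N :: "nat \<Rightarrow> nat"
  assumes L: "\<And>l. l < d \<Longrightarrow> 0 < L l" and N: "\<And>l. l < d \<Longrightarrow> 0 < N l"
    and K: "\<And>n. n > 0 \<Longrightarrow> centred_reps n (K n)"
begin

abbreviation "n \<equiv> num_nodes d N"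
abbreviation "W \<equiv> wave_numbers d K N"
abbreviation "ph \<equiv> phase d L N"

lemma n_pos: "n > 0"
  using N by (auto simp: num_nodes_def)

lemma finite_W: "finite W"
  using centred_repsD(1)[OF K[OF N] N] by (auto simp: wave_numbers_def intro!: finite_PiE)

lemma phase_eq: "ph \<kappa> j = (\<Sum>l<d. 2 * pi * of_int (\<kappa> l) * real (j l) / real (N l))"
  unfolding phase_def wave_vec_def
proof (rule sum.cong[OF refl])
  fix l assume "l \<in> {..<d}"
  hence "L l \<noteq> 0" using L[of l] by simp
  thus "2 * pi * of_int (\<kappa> l) / L l * (real (j l) * (L l / real (N l)))
      = 2 * pi * of_int (\<kappa> l) * real (j l) / real (N l)" by simp
qed

text \<open>The sum factors over directions. Different wave numbers differ in some direction, and
  two members of \<open>K (N l)\<close> are incongruent there, so that factor vanishes. This makes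
  distinct Fourier projections annihilate each other.\<close>

lemma sum_grid_cis:
  assumes k: "\<kappa> \<in> W" "\<kappa>' \<in> W"
  shows "(\<Sum>j\<in>grid d N. cis (ph \<kappa> j - ph \<kappa>' j)) = (if \<kappa> = \<kappa>' then of_nat n else 0)"
proof -
  have "ph \<kappa> j - ph \<kappa>' j = (\<Sum>l<d. 2 * pi * of_int (\<kappa> l - \<kappa>' l) * real (j l) / real (N l))" for j
    unfolding phase_eq sum_subtractf[symmetric] by (rule sum.cong) (auto simp: diff_divide_distrib algebra_simps)
  hence "(\<Sum>j\<in>grid d N. cis (ph \<kappa> j - ph \<kappa>' j))
      = (\<Sum>j\<in>grid d N. \<Prod>l<d. cis (2 * pi * of_int (\<kappa> l - \<kappa>' l) * real (j l) / real (N l)))"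
    by (simp only: cis_sum)
  also have "\<dots> = (\<Prod>l<d. \<Sum>t<N l. cis (2 * pi * of_int (\<kappa> l - \<kappa>' l) * real t / real (N l)))"
    unfolding grid_def by (rule prod_sum_PiE[symmetric]) auto
  also have "\<dots> = (\<Prod>l<d. if int (N l) dvd \<kappa> l - \<kappa>' l then of_nat (N l) else 0)"
    by (rule prod.cong[OF refl]) (rule sum_cis_roots, use N in auto)
  also have "\<dots> = (if \<kappa> = \<kappa>' then of_nat n else 0)"
  proof (cases "\<kappa> = \<kappa>'")
    case False
    then obtain l where ne: "\<kappa> l \<noteq> \<kappa>' l" by blast
    have l: "l < d"
      using k ne by (metis PiE_arb lessThan_iff wave_numbers_def)
    have "\<kappa> l \<in> K (N l)" "\<kappa>' l \<in> K (N l)" using k l by (auto simp: wave_numbers_def)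
    moreover have "inj_on (\<lambda>k. k mod int (N l)) (K (N l))" using K[OF N[OF l]] by (simp add: centred_reps_def)
    ultimately have "\<kappa> l mod int (N l) \<noteq> \<kappa>' l mod int (N l)" using ne by (auto dest: inj_onD)
    hence "\<not> int (N l) dvd \<kappa> l - \<kappa>' l" by (simp add: mod_eq_dvd_iff)
    thus ?thesis using False l by (auto intro!: prod_zero)
  qed (simp add: num_nodes_def)
  finally show ?thesis .
qed

text \<open>The dual orthogonality relation, by which the Fourier projections add up to the
  identity. Node indices in direction l are below \<open>N l\<close>, so different ones are
  incongruent.\<close>

lemma sum_wave_cis:
  assumes j: "j \<in> grid d N" "j' \<in> grid d N"
  shows "(\<Sum>\<kappa>\<in>W. cis (ph \<kappa> j - ph \<kappa> j')) = (if j = j' then of_nat n else 0)"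
proof -
  have "ph \<kappa> j - ph \<kappa> j' = (\<Sum>l<d. 2 * pi * of_int (int (j l) - int (j' l)) * of_int (\<kappa> l) / real (N l))" for \<kappa>
    unfolding phase_eq sum_subtractf[symmetric] by (rule sum.cong) (auto simp: diff_divide_distrib algebra_simps)
  hence "(\<Sum>\<kappa>\<in>W. cis (ph \<kappa> j - ph \<kappa> j'))
      = (\<Sum>\<kappa>\<in>W. \<Prod>l<d. cis (2 * pi * of_int (int (j l) - int (j' l)) * of_int (\<kappa> l) / real (N l)))"
    by (simp only: cis_sum)
  also have "\<dots> = (\<Prod>l<d. \<Sum>t\<in>K (N l). cis (2 * pi * of_int (int (j l) - int (j' l)) * of_int t / real (N l)))"
    unfolding wave_numbers_def by (rule prod_sum_PiE[symmetric]) (use centred_repsD(1)[OF K[OF N] N] in auto)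
  also have "\<dots> = (\<Prod>l<d. if int (N l) dvd int (j l) - int (j' l) then of_nat (N l) else 0)"
    by (rule prod.cong[OF refl]) (rule sum_cis_reps[OF K[OF N]], use N in auto)
  also have "\<dots> = (if j = j' then of_nat n else 0)"
  proof (cases "j = j'")
    case False
    then obtain l where ne: "j l \<noteq> j' l" by blast
    have l: "l < d" using j ne by (metis PiE_arb lessThan_iff grid_def)
    have "j l < N l" "j' l < N l" using j l by (auto simp: grid_def)
    hence "int (j l) mod int (N l) \<noteq> int (j' l) mod int (N l)" using ne by simp
    hence "\<not> int (N l) dvd int (j l) - int (j' l)" by (simp add: mod_eq_dvd_iff)
    thus ?thesis using False l by (auto intro!: prod_zero)
  qed (simp add: num_nodes_def)
  finally show ?thesis .
qed

text \<open>The rank-one orthogonal projector onto a plane wave: the wave times its conjugate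
  transpose, divided by the squared norm n.\<close>

definition fourier_proj :: "(nat \<Rightarrow> int) \<Rightarrow> complex mat" where
  "fourier_proj \<kappa> = Matrix.mat n n (\<lambda>(r, s). cis (ph \<kappa> (node d N r) - ph \<kappa> (node d N s)) / of_nat n)"

lemma fourier_proj_carrier: "fourier_proj \<kappa> \<in> carrier_mat n n"
  by (simp add: fourier_proj_def)

lemma fourier_proj_index:
  "r < n \<Longrightarrow> s < n \<Longrightarrow>
   fourier_proj \<kappa> $$ (r, s) = cis (ph \<kappa> (node d N r) - ph \<kappa> (node d N s)) / of_nat n"
  by (simp add: fourier_proj_def)

lemma node_grid: "r < n \<Longrightarrow> node d N r \<in> grid d N"
  using bij_betw_node[of d N] by (auto simp: bij_betw_def)

lemma sum_nodes: "(\<Sum>t = 0..<n. f (node d N t)) = (\<Sum>j\<in>grid d N. f j)"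
  unfolding atLeast0LessThan by (rule sum.reindex_bij_betw[OF bij_betw_node])

lemma node_eq_iff: "r < n \<Longrightarrow> s < n \<Longrightarrow> node d N r = node d N s \<longleftrightarrow> r = s"
  using bij_betw_node[of d N] by (auto simp: bij_betw_def dest: inj_onD)

lemma fourier_proj_sum:
  assumes "r < n" "s < n"
  shows "(\<Sum>\<kappa>\<in>W. fourier_proj \<kappa> $$ (r, s)) = (if r = s then 1 else 0)"
  using assms n_pos sum_wave_cis[OF node_grid[OF assms(1)] node_grid[OF assms(2)]]
  by (simp add: fourier_proj_index sum_divide_distrib[symmetric] node_eq_iff)

lemma fourier_proj_mult:
  assumes k: "\<kappa> \<in> W" "\<kappa>' \<in> W" and rs: "r < n" "s < n"
  shows "(\<Sum>t = 0..<n. fourier_proj \<kappa> $$ (r, t) * fourier_proj \<kappa>' $$ (t, s))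
    = (if \<kappa> = \<kappa>' then fourier_proj \<kappa> $$ (r, s) else 0)"
proof -
  let ?c = "cis (ph \<kappa> (node d N r) - ph \<kappa>' (node d N s)) / (of_nat n * of_nat n)"
  have "(\<Sum>t = 0..<n. fourier_proj \<kappa> $$ (r, t) * fourier_proj \<kappa>' $$ (t, s))
      = (\<Sum>t = 0..<n. ?c * cis (ph \<kappa>' (node d N t) - ph \<kappa> (node d N t)))"
    by (rule sum.cong) (use rs in \<open>auto simp: fourier_proj_index cis_mult algebra_simps\<close>)
  also have "\<dots> = ?c * (\<Sum>j\<in>grid d N. cis (ph \<kappa>' j - ph \<kappa> j))"
    unfolding sum_distrib_left[symmetric] sum_nodes[of "\<lambda>j. cis (ph \<kappa>' j - ph \<kappa> j)"] ..
  also have "\<dots> = (if \<kappa> = \<kappa>' then fourier_proj \<kappa> $$ (r, s) else 0)"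
    using sum_grid_cis[OF k(2,1)] n_pos rs by (auto simp: fourier_proj_index)
  finally show ?thesis .
qed

abbreviation "Lap \<equiv> neg_laplacian_mat d L K N"

lemma Lap_carrier: "Lap \<in> carrier_mat n n"
  by (simp add: neg_laplacian_mat_def)

text \<open>The transform of a nodal indicator is one conjugate exponential over n. By
  \<open>neg_laplacian_real\<close> the \<open>Re\<close> in \<open>neg_laplacian_mat\<close>
  discards nothing, so the spectral decomposition holds entrywise.\<close>

lemma Lap_index:
  assumes rs: "r < n" "s < n"
  shows "complex_of_real (Lap $$ (r, s)) = (\<Sum>\<kappa>\<in>W. of_real (wave_norm2 d L \<kappa>) * fourier_proj \<kappa> $$ (r, s))"
proof -
  let ?u = "\<lambda>x. if x = node d N s then 1 else 0 :: complex"
  have fg: "finite (grid d N)" by (auto simp: grid_def intro!: finite_PiE)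
  have dft: "dft d L N ?u \<kappa> = cis (- ph \<kappa> (node d N s)) / of_nat n" for \<kappa>
    using node_grid[OF rs(2)] fg by (simp add: dft_def if_distrib[of "\<lambda>t. t * _"] cong: if_cong)
  have "neg_laplacian d L K N ?u (node d N r) \<in> \<real>"
    by (rule neg_laplacian_real[OF K N L]) (use node_grid[OF rs(1)] in auto)
  hence "complex_of_real (Lap $$ (r, s)) = neg_laplacian d L K N ?u (node d N r)"
    using rs by (simp add: neg_laplacian_mat_def)
  also have "\<dots> = (\<Sum>\<kappa>\<in>W. of_real (wave_norm2 d L \<kappa>) * fourier_proj \<kappa> $$ (r, s))"
    unfolding neg_laplacian_def dft
    by (rule sum.cong) (use rs in \<open>auto simp: fourier_proj_index cis_mult mult.assoc\<close>)
  finally show ?thesis .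
qed

text \<open>The entries are weighted sums of cosines of phase differences, hence even under exchange
  of the two nodes.\<close>

lemma Lap_symmetric: "Lap\<^sup>T = Lap"
proof (rule eq_matI)
  fix r s assume "r < dim_row Lap" "s < dim_col Lap"
  hence rs: "r < n" "s < n" using Lap_carrier by auto
  have "Lap $$ (a, b) = (\<Sum>\<kappa>\<in>W. wave_norm2 d L \<kappa> * (cos (ph \<kappa> (node d N a) - ph \<kappa> (node d N b)) / real n))"
    if "a < n" "b < n" for a b
  proof -
    have "Lap $$ (a, b) = Re (complex_of_real (Lap $$ (a, b)))" by simp
    also have "\<dots> = (\<Sum>\<kappa>\<in>W. wave_norm2 d L \<kappa> * (cos (ph \<kappa> (node d N a) - ph \<kappa> (node d N b)) / real n))"
      unfolding Lap_index[OF that] Re_sum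
      by (rule sum.cong) (use that in \<open>auto simp: fourier_proj_index Re_divide_of_nat\<close>)
    finally show ?thesis .
  qed
  moreover have "cos (x - y) = cos (y - x)" for x y :: real by (metis cos_minus minus_diff_eq)
  ultimately show "Lap\<^sup>T $$ (r, s) = Lap $$ (r, s)" using rs Lap_carrier by simp
qed (use Lap_carrier in auto)

lemma eigenmat_Lap:
  assumes k: "\<kappa> \<in> W"
  shows "eigenmat (complex_mat Lap) (fourier_proj \<kappa>) (of_real (wave_norm2 d L \<kappa>))"
  unfolding eigenmat_def
proof (intro conjI; rule eq_matI)
  let ?w = "\<lambda>\<kappa>. complex_of_real (wave_norm2 d L \<kappa>)"
  fix r s
  assume "r < dim_row (?w \<kappa> \<cdot>\<^sub>m fourier_proj \<kappa>)" "s < dim_col (?w \<kappa> \<cdot>\<^sub>m fourier_proj \<kappa>)"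
  hence rs: "r < n" "s < n" using fourier_proj_carrier[of \<kappa>] by auto
  have "(complex_mat Lap * fourier_proj \<kappa>) $$ (r, s)
      = (\<Sum>t = 0..<n. complex_of_real (Lap $$ (r, t)) * fourier_proj \<kappa> $$ (t, s))"
    using rs Lap_carrier fourier_proj_carrier[of \<kappa>] by (simp add: scalar_prod_def)
  also have "\<dots> = (\<Sum>t = 0..<n. \<Sum>\<kappa>'\<in>W. ?w \<kappa>' * (fourier_proj \<kappa>' $$ (r, t) * fourier_proj \<kappa> $$ (t, s)))"
    by (rule sum.cong) (use rs in \<open>auto simp: Lap_index sum_distrib_right mult.assoc\<close>)
  also have "\<dots> = (\<Sum>\<kappa>'\<in>W. ?w \<kappa>' * (\<Sum>t = 0..<n. fourier_proj \<kappa>' $$ (r, t) * fourier_proj \<kappa> $$ (t, s)))"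
    unfolding sum_distrib_left by (rule sum.swap)
  also have "\<dots> = (\<Sum>\<kappa>'\<in>W. if \<kappa>' = \<kappa> then ?w \<kappa> * fourier_proj \<kappa> $$ (r, s) else 0)"
    by (rule sum.cong) (auto simp: fourier_proj_mult[OF _ k rs])
  also have "\<dots> = ?w \<kappa> * fourier_proj \<kappa> $$ (r, s)" using k finite_W by simp
  finally show "(complex_mat Lap * fourier_proj \<kappa>) $$ (r, s) = (?w \<kappa> \<cdot>\<^sub>m fourier_proj \<kappa>) $$ (r, s)"
    using rs fourier_proj_carrier[of \<kappa>] by simp
  have "(fourier_proj \<kappa> * complex_mat Lap) $$ (r, s)
      = (\<Sum>t = 0..<n. fourier_proj \<kappa> $$ (r, t) * complex_of_real (Lap $$ (t, s)))"
    using rs Lap_carrier fourier_proj_carrier[of \<kappa>] by (simp add: scalar_prod_def)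
  also have "\<dots> = (\<Sum>t = 0..<n. \<Sum>\<kappa>'\<in>W. ?w \<kappa>' * (fourier_proj \<kappa> $$ (r, t) * fourier_proj \<kappa>' $$ (t, s)))"
    by (rule sum.cong) (use rs in \<open>auto simp: Lap_index sum_distrib_left mult_ac\<close>)
  also have "\<dots> = (\<Sum>\<kappa>'\<in>W. ?w \<kappa>' * (\<Sum>t = 0..<n. fourier_proj \<kappa> $$ (r, t) * fourier_proj \<kappa>' $$ (t, s)))"
    unfolding sum_distrib_left by (rule sum.swap)
  also have "\<dots> = (\<Sum>\<kappa>'\<in>W. if \<kappa>' = \<kappa> then ?w \<kappa> * fourier_proj \<kappa> $$ (r, s) else 0)"
    by (rule sum.cong) (auto simp: fourier_proj_mult[OF k _ rs])
  also have "\<dots> = ?w \<kappa> * fourier_proj \<kappa> $$ (r, s)" using k finite_W by simp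
  finally show "(fourier_proj \<kappa> * complex_mat Lap) $$ (r, s) = (?w \<kappa> \<cdot>\<^sub>m fourier_proj \<kappa>) $$ (r, s)"
    using rs fourier_proj_carrier[of \<kappa>] by simp
qed (use Lap_carrier fourier_proj_carrier[of \<kappa>] in auto)

lemma zero_in_W: "(\<lambda>l\<in>{..<d}. 0) \<in> W"
  using centred_reps_zero[OF K[OF N] N] by (auto simp: wave_numbers_def)

lemma wave_norm2_nonneg: "wave_norm2 d L \<kappa> \<ge> 0"
  by (simp add: wave_norm2_def sum_nonneg)

lemma wave_norm2_zero: "wave_norm2 d L (\<lambda>l\<in>{..<d}. 0) = 0"
  by (simp add: wave_norm2_def wave_vec_def)

text \<open>Tested on the wave vector with the highest frequency in direction l and zero in all
  others.\<close>

lemma max_wave_norm2_ge: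
  assumes l: "l < d"
  shows "(2 * pi * real (N l div 2) / L l)\<^sup>2 \<le> Max (wave_norm2 d L ` W)"
proof -
  obtain k where k: "k \<in> K (N l)" "\<bar>k\<bar> = int (N l div 2)"
    using centred_reps_half[OF K[OF N[OF l]] N[OF l]] by blast
  define \<kappa> where "\<kappa> = (\<lambda>i\<in>{..<d}. if i = l then k else 0)"
  have W: "\<kappa> \<in> W" using k centred_reps_zero[OF K[OF N] N] by (auto simp: \<kappa>_def wave_numbers_def)
  have "\<bar>of_int k\<bar> = real (N l div 2)" using arg_cong[OF k(2), of real_of_int] by simp
  hence "(of_int k)\<^sup>2 = (real (N l div 2))\<^sup>2" by (metis power2_abs)
  hence "(2 * pi * real (N l div 2) / L l)\<^sup>2 = (wave_vec L \<kappa> l)\<^sup>2"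
    using l by (simp add: wave_vec_def \<kappa>_def power_mult_distrib power_divide)
  also have "\<dots> \<le> wave_norm2 d L \<kappa>"
    unfolding wave_norm2_def using l by (intro member_le_sum) auto
  also have "\<dots> \<le> Max (wave_norm2 d L ` W)" using W finite_W by simp
  finally show ?thesis .
qed

end

section \<open>The optimal shift\<close>

context
  fixes a b :: real
  assumes a: "0 < a" and ab: "a \<le> b"
begin

lemma sqrt_ratio: "(sqrt (b / a) - 1) / (sqrt (b / a) + 1) = (sqrt b - sqrt a) / (sqrt b + sqrt a)"
proof -
  have "sqrt a > 0" using a by simp
  moreover have "sqrt b \<ge> 0" using a ab by simp
  ultimately show ?thesis by (simp add: real_sqrt_divide divide_simps)
qed

text \<open>With u = sqrt a and v = sqrt b both end-point ratios equal (v - u) / (v + u) at lam = u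
  v. To the right of that point the ratio at a is at least this value, to the left the ratio at b
  is; cross-multiplied, each case is the comparison of lam with u v.\<close>

lemma rate_le_max_ratio:
  assumes lam: "lam > 0"
  shows "(sqrt (b / a) - 1) / (sqrt (b / a) + 1) \<le> max (\<bar>lam - a\<bar> / (lam + a)) (\<bar>lam - b\<bar> / (lam + b))"
proof -
  define u v where "u = sqrt a" and "v = sqrt b"
  have u: "u > 0" "a = u * u" and v: "v > 0" "b = v * v" using a ab by (auto simp: u_def v_def)
  have "(v - u) / (v + u) \<le> max (\<bar>lam - u * u\<bar> / (lam + u * u)) (\<bar>lam - v * v\<bar> / (lam + v * v))"
  proof (cases "lam \<ge> u * v")
    case True
    hence "u * (u * v) \<le> u * lam" using u by (intro mult_left_mono) auto
    hence "(v - u) * (lam + u * u) \<le> (lam - u * u) * (v + u)" by (simp add: algebra_simps)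
    moreover have "lam + u * u > 0" using lam by (simp add: add_pos_nonneg)
    ultimately have "(v - u) / (v + u) \<le> (lam - u * u) / (lam + u * u)"
      using u v by (simp add: pos_divide_le_eq pos_le_divide_eq mult.commute)
    also have "\<dots> \<le> \<bar>lam - u * u\<bar> / (lam + u * u)"
      using \<open>lam + u * u > 0\<close> by (intro divide_right_mono) auto
    finally show ?thesis by simp
  next
    case False
    hence "v * lam \<le> v * (u * v)" using v by (intro mult_left_mono) auto
    hence "(v - u) * (lam + v * v) \<le> (v * v - lam) * (v + u)" by (simp add: algebra_simps)
    moreover have "lam + v * v > 0" using lam by (simp add: add_pos_nonneg)
    ultimately have "(v - u) / (v + u) \<le> (v * v - lam) / (lam + v * v)"
      using u v by (simp add: pos_divide_le_eq pos_le_divide_eq mult.commute)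
    also have "\<dots> \<le> \<bar>lam - v * v\<bar> / (lam + v * v)"
      using \<open>lam + v * v > 0\<close> by (intro divide_right_mono) auto
    finally show ?thesis by simp
  qed
  thus ?thesis unfolding sqrt_ratio u(2)[symmetric] v(2)[symmetric] by (simp only: u_def v_def)
qed

text \<open>Cross-multiplied, the two signs of the absolute value reduce to x \<le> v^2 and u^2
  \<le> x.\<close>

lemma ratio_at_geometric_mean_le:
  assumes x: "a \<le> x" "x \<le> b"
  shows "\<bar>sqrt a * sqrt b - x\<bar> / (sqrt a * sqrt b + x) \<le> (sqrt (b / a) - 1) / (sqrt (b / a) + 1)"
proof -
  define u v where "u = sqrt a" and "v = sqrt b"
  have u: "u > 0" "a = u * u" and v: "v > 0" "b = v * v" using a ab by (auto simp: u_def v_def)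
  have "u * v > 0" using u v by simp
  hence pos: "u * v + x > 0" using x a by linarith
  have "u * x \<le> u * (v * v)" using x v u by (intro mult_left_mono) auto
  hence "(x - u * v) * (v + u) \<le> (v - u) * (u * v + x)" by (simp add: algebra_simps)
  moreover have "v * (u * u) \<le> v * x" using x u v by (intro mult_left_mono) auto
  hence "(u * v - x) * (v + u) \<le> (v - u) * (u * v + x)" by (simp add: algebra_simps)
  ultimately have "\<bar>u * v - x\<bar> * (v + u) \<le> (v - u) * (u * v + x)" by (simp add: abs_if)
  hence "\<bar>u * v - x\<bar> / (u * v + x) \<le> (v - u) / (v + u)"
    using u v pos by (simp add: pos_divide_le_eq pos_le_divide_eq mult.commute)
  thus ?thesis unfolding sqrt_ratio by (simp add: u_def v_def)
qed

end

text \<open>The quotient is 1 - 2 / (1 + sqrt x) for nonnegative x.\<close>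

lemma rate_tendsto_1: "((\<lambda>x::real. (sqrt x - 1) / (sqrt x + 1)) \<longlongrightarrow> 1) at_top"
proof -
  have "filterlim (\<lambda>x::real. 1 + sqrt x) at_top at_top"
    by (rule filterlim_tendsto_add_at_top[OF tendsto_const sqrt_at_top])
  hence "((\<lambda>x::real. 1 - 2 / (1 + sqrt x)) \<longlongrightarrow> 1 - 0) at_top"
    by (intro tendsto_diff tendsto_const tendsto_divide_0[OF tendsto_const] filterlim_at_top_imp_at_infinity)
  moreover have "eventually (\<lambda>x::real. 1 - 2 / (1 + sqrt x) = (sqrt x - 1) / (sqrt x + 1)) at_top"
    using eventually_ge_at_top[of 0]
  proof eventually_elim
    case (elim x)
    hence "1 + sqrt x > 0" by (simp add: add_pos_nonneg)
    thus ?case by (simp add: field_simps)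
  qed
  ultimately show ?thesis by (simp add: filterlim_cong)
qed

section \<open>Spectral radius and optimal shift on one grid\<close>

context fourier_grid
begin

context
  fixes \<alpha> \<theta> C k :: real and m :: "real^3" and Z :: "real mat"
  assumes \<alpha>: "\<alpha> > 0" and c: "\<theta> * k * C > 0" and m: "norm m = 1"
    and tb: "tangent_basis n (\<lambda>i. m) Z"
begin

abbreviation "ev \<kappa> \<equiv> \<alpha> + \<theta> * k * C * wave_norm2 d L \<kappa>"
abbreviation "\<beta> \<equiv> beta_h d L K \<alpha> \<theta> C N k"
abbreviation "HT \<equiv> tangent_reduce Z (H_mat d L K \<alpha> \<theta> C N k)"
abbreviation "ST \<equiv> tangent_reduce Z (S_mat n (\<lambda>i. m))"

lemma ev_bounds: "\<kappa> \<in> W \<Longrightarrow> \<alpha> \<le> ev \<kappa>" "\<kappa> \<in> W \<Longrightarrow> ev \<kappa> \<le> \<beta>"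
  using c finite_W wave_norm2_nonneg by (auto simp: beta_h_def intro!: mult_left_mono Max_ge)

lemma ev_attained: "\<alpha> \<in> ev ` W" "\<beta> \<in> ev ` W"
proof -
  show "\<alpha> \<in> ev ` W" using zero_in_W wave_norm2_zero by (intro image_eqI[of _ _ "\<lambda>l\<in>{..<d}. 0"]) auto
  have "Max (wave_norm2 d L ` W) \<in> wave_norm2 d L ` W"
    using finite_W zero_in_W by (intro Max_in) auto
  then obtain \<kappa> where "\<kappa> \<in> W" "Max (wave_norm2 d L ` W) = wave_norm2 d L \<kappa>" by blast
  thus "\<beta> \<in> ev ` W" by (auto simp: beta_h_def)
qed

lemma tangent_pair_grid:
  "tangent_pair (2 * n) HT ST W (\<lambda>\<kappa>. (complex_mat Z)\<^sup>T * kron (fourier_proj \<kappa>) (1\<^sub>m 3) * complex_mat Z) ev"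
  unfolding H_mat_def
proof (rule tangent_pair_compression[OF m tb])
  let ?A = "\<alpha> \<cdot>\<^sub>m 1\<^sub>m n + (\<theta> * k * C) \<cdot>\<^sub>m Lap"
  show "?A \<in> carrier_mat n n" using Lap_carrier by simp
  show "?A\<^sup>T = ?A"
    using Lap_carrier arg_cong[OF Lap_symmetric, of "\<lambda>M. M $$ _"]
    by (intro eq_matI) (auto, metis Lap_symmetric carrier_matD index_transpose_mat(1))
  show "n > 0" by (rule n_pos)
  fix \<kappa> assume k: "\<kappa> \<in> W"
  note F = fourier_proj_carrier[of \<kappa>]
  show "fourier_proj \<kappa> \<in> carrier_mat n n" by (rule F)
  have Lc: "complex_mat Lap \<in> carrier_mat n n" using Lap_carrier by simp
  have "complex_mat ?A = of_real \<alpha> \<cdot>\<^sub>m 1\<^sub>m n + of_real (\<theta> * k * C) \<cdot>\<^sub>m complex_mat Lap"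
    using Lap_carrier by (auto intro!: eq_matI)
  thus "eigenmat (complex_mat ?A) (fourier_proj \<kappa>) (of_real (ev \<kappa>))"
    using eigenmat_add[OF F _ _ eigenmat_smult[OF F one_carrier_mat eigenmat_one[OF F]]
        eigenmat_smult[OF F Lc eigenmat_Lap[OF k]], of "of_real \<alpha>" "of_real (\<theta> * k * C)"] Lc
    by simp
  show "fourier_proj \<kappa> $$ (0, 0) \<noteq> 0" using n_pos by (simp add: fourier_proj_index)
  show "ev \<kappa> > 0" using ev_bounds(1)[OF k] \<alpha> by linarith
next
  fix r s assume "r < n" "s < n"
  thus "(\<Sum>\<kappa>\<in>W. fourier_proj \<kappa> $$ (r, s)) = (if r = s then 1 else 0)" by (rule fourier_proj_sum)
qed

interpretation tp: tangent_pair "2 * n" HT ST W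
  "\<lambda>\<kappa>. (complex_mat Z)\<^sup>T * kron (fourier_proj \<kappa>) (1\<^sub>m 3) * complex_mat Z" ev
  by (rule tangent_pair_grid)

abbreviation "\<rho> lam \<equiv> spectral_radius (complex_mat (T_mat HT ST lam))"
abbreviation "rate \<equiv> (sqrt (\<beta> / \<alpha>) - 1) / (sqrt (\<beta> / \<alpha>) + 1)"

lemma spectral_radius_T:
  assumes "lam > 0"
  shows "\<rho> lam = Max ((\<lambda>\<mu>. cmod ((of_real lam - \<mu>) / (of_real lam + \<mu>))) ` spectrum (complex_mat HT))"
  unfolding spectral_radius_def tp.norm_spectrum_T[OF assms] ..

lemma spectral_radius_T_real:
  assumes lam: "lam > 0"
  shows "\<rho> lam = Max ((\<lambda>x. \<bar>lam - x\<bar> / (lam + x)) ` ev ` W)"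
proof -
  have "cmod ((of_real lam - of_real x) / (of_real lam + of_real x)) = \<bar>lam - x\<bar> / (lam + x)"
    if "x \<in> ev ` W" for x
  proof -
    have "lam + x > 0" using that ev_bounds(1) \<alpha> lam by fastforce
    thus ?thesis by (simp flip: of_real_diff of_real_add of_real_divide)
  qed
  hence "(\<lambda>\<mu>. cmod ((of_real lam - \<mu>) / (of_real lam + \<mu>))) ` (\<lambda>\<kappa>. of_real (ev \<kappa>)) ` W
      = (\<lambda>x. \<bar>lam - x\<bar> / (lam + x)) ` ev ` W"
    unfolding image_image by (intro image_cong refl) blast
  thus ?thesis unfolding spectral_radius_T[OF lam] tp.spectrum_H by (rule arg_cong)
qed

text \<open>Both \<alpha> and \<beta> are eigenvalues, so the maximum dominates the ratios at both
  end points.\<close>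

lemma rate_le_spectral_radius:
  assumes lam: "lam > 0"
  shows "rate \<le> \<rho> lam"
proof -
  have "finite ((\<lambda>x. \<bar>lam - x\<bar> / (lam + x)) ` ev ` W)" using finite_W by simp
  hence "\<bar>lam - x\<bar> / (lam + x) \<le> \<rho> lam" if "x \<in> ev ` W" for x
    unfolding spectral_radius_T_real[OF lam] by (rule Max_ge) (use that in blast)
  from this[OF ev_attained(1)] this[OF ev_attained(2)]
  show ?thesis using rate_le_max_ratio[OF \<alpha> _ lam, of \<beta>] ev_bounds zero_in_W by fastforce
qed

lemma alpha_le_beta: "\<alpha> \<le> \<beta>"
  using ev_bounds[OF zero_in_W] by linarith

lemma ex_optimal_shift: "\<exists>lam>0. \<rho> lam = rate"
proof (intro exI conjI)
  let ?l = "sqrt \<alpha> * sqrt \<beta>"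
  show l: "?l > 0" using \<alpha> alpha_le_beta by simp
  have "\<rho> ?l \<le> rate"
    unfolding spectral_radius_T_real[OF l]
  proof (rule Max.boundedI)
    fix y assume "y \<in> (\<lambda>x. \<bar>?l - x\<bar> / (?l + x)) ` ev ` W"
    then obtain \<kappa> where "\<kappa> \<in> W" "y = \<bar>?l - ev \<kappa>\<bar> / (?l + ev \<kappa>)" by blast
    thus "y \<le> rate" using ratio_at_geometric_mean_le[OF \<alpha> alpha_le_beta ev_bounds] by simp
  qed (use finite_W zero_in_W in auto)
  thus "\<rho> ?l = rate" using rate_le_spectral_radius[OF l] by linarith
qed

lemma tangent_grid_facts:
  "HT * ST = ST * HT"
  "lam > 0 \<Longrightarrow> invertible_mat (lam \<cdot>\<^sub>m 1\<^sub>m (2 * n) + ST)"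
  "lam > 0 \<Longrightarrow> invertible_mat (lam \<cdot>\<^sub>m 1\<^sub>m (2 * n) + HT)"
  "lam > 0 \<Longrightarrow> normal_mat (T_mat HT ST lam)"
  using tp.HS tp.invertible_shift tp.normal_T_mat by blast+

end

text \<open>The direction l that realizes h carries a wave vector of length 2 pi (N l div 2) / L l,
  which is at least 1 / h as soon as that direction has two points.\<close>

lemma beta_h_ge:
  assumes c: "\<theta> * k * C > 0" and d: "d > 0"
    and h: "mesh_width d L N < Min (L ` {..<d})"
  shows "\<alpha> + \<theta> * k * C / (mesh_width d L N)\<^sup>2 \<le> beta_h d L K \<alpha> \<theta> C N k"
proof -
  let ?h = "mesh_width d L N"
  have "?h \<in> (\<lambda>l. L l / real (N l)) ` {..<d}"
    unfolding mesh_width_def using d by (intro Min_in) auto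
  then obtain l where l: "l < d" "?h = L l / real (N l)" by auto
  have Ll: "L l > 0" and Nl: "N l > 0" using L N l by auto
  have "?h < L l" using h l(1) by (metis Min_less_iff finite_imageI finite_lessThan image_eqI
      image_is_empty lessThan_iff empty_iff less_le_trans Min_le)
  \<comment> \<open>A single point would give h = L l. This case has to be excluded since 1 div 2 =
    0 makes the frequency bound void.\<close>
  hence "N l \<noteq> 1" using l by auto
  \<comment> \<open>The factor 3 is attained at N l = 3, and 3 \<le> 2 pi absorbs it.\<close>
  hence "N l \<le> 3 * (N l div 2)" using Nl by presburger
  hence N3: "real (N l) \<le> 3 * real (N l div 2)" by linarith
  have "3 * real (N l div 2) \<le> 2 * pi * real (N l div 2)"
    using pi_ge_two by (intro mult_right_mono) auto
  hence "real (N l) / L l \<le> 2 * pi * real (N l div 2) / L l"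
    using N3 Ll by (intro divide_right_mono) auto
  hence "(real (N l) / L l)\<^sup>2 \<le> (2 * pi * real (N l div 2) / L l)\<^sup>2"
    using Ll by (intro power_mono) auto
  also have "\<dots> \<le> Max (wave_norm2 d L ` W)" by (rule max_wave_norm2_ge[OF l(1)])
  finally have "1 / ?h\<^sup>2 \<le> Max (wave_norm2 d L ` W)" by (simp add: l power_divide)
  from mult_left_mono[OF this, of "\<theta> * k * C"] c show ?thesis by (simp add: beta_h_def)
qed

end

text \<open>As h tends to 0 it eventually falls below the smallest period, so
  \<open>beta_h_ge\<close> bounds \<beta> / \<alpha> below by a positive constant times k /
  h^2.\<close>

lemma rate_tendsto_1_family:
  fixes k :: "'i \<Rightarrow> real"
  assumes L: "\<And>l. l < d \<Longrightarrow> 0 < L l" and K: "\<And>n. n > 0 \<Longrightarrow> centred_reps n (K n)"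
    and N: "\<And>i l. l < d \<Longrightarrow> N i l > 0" and k: "\<And>i. k i > 0" and d: "d > 0"
    and \<alpha>: "\<alpha> > 0" and \<theta>C: "\<theta> * C > 0"
    and h: "((\<lambda>i. mesh_width d L (N i)) \<longlongrightarrow> 0) F"
    and kh: "filterlim (\<lambda>i. k i / (mesh_width d L (N i))\<^sup>2) at_top F"
  shows "((\<lambda>i. (sqrt (beta_h d L K \<alpha> \<theta> C (N i) (k i) / \<alpha>) - 1)
    / (sqrt (beta_h d L K \<alpha> \<theta> C (N i) (k i) / \<alpha>) + 1)) \<longlongrightarrow> 1) F"
proof (rule filterlim_compose[OF rate_tendsto_1])
  have "Min (L ` {..<d}) > 0" using d L by (subst Min_gr_iff) auto
  hence "\<forall>\<^sub>F i in F. mesh_width d L (N i) < Min (L ` {..<d})" using order_tendstoD(2)[OF h] by blast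
  hence "\<forall>\<^sub>F i in F. \<theta> * C / \<alpha> * (k i / (mesh_width d L (N i))\<^sup>2) \<le> beta_h d L K \<alpha> \<theta> C (N i) (k i) / \<alpha>"
  proof eventually_elim
    case (elim i)
    interpret fourier_grid d L K "N i" using L N K by unfold_locales
    have "\<theta> * k i * C > 0" using mult_pos_pos[OF \<theta>C k[of i]] by (simp add: mult_ac)
    from beta_h_ge[OF this d elim, of \<alpha>]
    have "\<theta> * k i * C / (mesh_width d L (N i))\<^sup>2 \<le> beta_h d L K \<alpha> \<theta> C (N i) (k i)" using \<alpha> by simp
    from divide_right_mono[OF this, of \<alpha>] \<alpha> show ?case by (simp add: mult_ac)
  qed
  moreover have "filterlim (\<lambda>i. \<theta> * C / \<alpha> * (k i / (mesh_width d L (N i))\<^sup>2)) at_top F"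
    using \<alpha> \<theta>C by (intro filterlim_tendsto_pos_mult_at_top[OF tendsto_const _ kh]) simp
  ultimately show "filterlim (\<lambda>i. beta_h d L K \<alpha> \<theta> C (N i) (k i) / \<alpha>) at_top F"
    by (rule filterlim_at_top_mono[rotated])
qed

text \<open>The minimum over shifts appears as a lower bound together with a shift attaining it. The
  invertibility clauses ensure that \<open>T_mat\<close> contains actual inverses. Families are
  indexed through a filter, and basis and shift may depend on the index; the trivial filter must be
  excluded from the last clause because every bound holds eventually along it.\<close>

theorem mainTheorem7:
  fixes d :: nat and \<alpha> C \<theta> :: real and L :: "nat \<Rightarrow> real" and m :: "real^3"
    and K :: "nat \<Rightarrow> int set"
  assumes "d \<in> {2, 3}" and "\<alpha> > 0" and "C > 0" and "\<theta> \<in> {1, 1 / 2}"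
    and "\<And>l. l < d \<Longrightarrow> L l > 0" and "norm m = 1"
    and "\<And>n. n > 0 \<Longrightarrow> centred_reps n (K n)"
  defines "HT \<equiv> \<lambda>N k Z. tangent_reduce Z (H_mat d L K \<alpha> \<theta> C N k)"
    and "ST \<equiv> \<lambda>N Z. tangent_reduce Z (S_mat (num_nodes d N) (\<lambda>i. m))"
  defines "T \<equiv> \<lambda>N k Z. T_mat (HT N k Z) (ST N Z)"
  defines "\<rho> \<equiv> \<lambda>N k Z lam. spectral_radius (complex_mat (T N k Z lam))"
    and "rate \<equiv> \<lambda>N k. (sqrt (beta_h d L K \<alpha> \<theta> C N k / \<alpha>) - 1)
                       / (sqrt (beta_h d L K \<alpha> \<theta> C N k / \<alpha>) + 1)"
  shows
    "(\<forall>N. (\<forall>l<d. N l > 0) \<longrightarrow>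
        (\<exists>Z. tangent_basis (num_nodes d N) (\<lambda>i. m) Z
           \<and> spatially_constant_basis (num_nodes d N) m Z))
   \<and> (\<forall>N k Z. (\<forall>l<d. N l > 0) \<and> k > 0 \<and> tangent_basis (num_nodes d N) (\<lambda>i. m) Z \<longrightarrow>
        HT N k Z * ST N Z = ST N Z * HT N k Z
      \<and> (\<forall>lam>0.
            invertible_mat (lam \<cdot>\<^sub>m 1\<^sub>m (2 * num_nodes d N) + ST N Z)
          \<and> invertible_mat (lam \<cdot>\<^sub>m 1\<^sub>m (2 * num_nodes d N) + HT N k Z)
          \<and> normal_mat (T N k Z lam)
          \<and> \<rho> N k Z lam = Max ((\<lambda>\<mu>. cmod ((of_real lam - \<mu>) / (of_real lam + \<mu>)))
                              ` spectrum (complex_mat (HT N k Z))))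
      \<and> (\<exists>lam>0. \<rho> N k Z lam = rate N k)
      \<and> (\<forall>lam>0. rate N k \<le> \<rho> N k Z lam))
   \<and> (\<forall>(F :: 'i filter) N k.
        (\<forall>i. (\<forall>l<d. N i l > 0) \<and> k i > 0)
      \<and> ((\<lambda>i. mesh_width d L (N i)) \<longlongrightarrow> 0) F
      \<and> filterlim (\<lambda>i. k i / (mesh_width d L (N i))\<^sup>2) at_top F \<longrightarrow>
        ((\<lambda>i. rate (N i) (k i)) \<longlongrightarrow> 1) F
      \<and> (F \<noteq> bot \<longrightarrow>
          (\<forall>Z lam. (\<forall>i. tangent_basis (num_nodes d (N i)) (\<lambda>_. m) (Z i) \<and> lam i > 0) \<longrightarrow>
             \<not> (\<exists>q<1. \<forall>\<^sub>F i in F. \<rho> (N i) (k i) (Z i) (lam i) \<le> q))))"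
proof -
  have \<theta>: "\<theta> > 0" and d: "d > 0" using assms(1,4) by auto
  have grid: "fourier_grid d L K N" if "\<forall>l<d. N l > 0" for N
    using that assms(5,7) by unfold_locales auto
  have basis: "\<exists>Z. tangent_basis (num_nodes d N) (\<lambda>i. m) Z \<and> spatially_constant_basis (num_nodes d N) m Z"
    for N using ex_spatially_constant_basis[OF assms(6)] .
  have rate_le: "rate N k \<le> \<rho> N k Z lam"
    if "\<forall>l<d. N l > 0" "k > 0" "tangent_basis (num_nodes d N) (\<lambda>i. m) Z" "lam > 0" for N k Z lam
    using fourier_grid.rate_le_spectral_radius[OF grid[OF that(1)] assms(2) _ assms(6) that(3,4)]
      \<theta> assms(3) that(2)
    by (simp add: rate_def \<rho>_def T_def HT_def ST_def)
  have fixed: "HT N k Z * ST N Z = ST N Z * HT N k Z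
      \<and> (\<forall>lam>0.
            invertible_mat (lam \<cdot>\<^sub>m 1\<^sub>m (2 * num_nodes d N) + ST N Z)
          \<and> invertible_mat (lam \<cdot>\<^sub>m 1\<^sub>m (2 * num_nodes d N) + HT N k Z)
          \<and> normal_mat (T N k Z lam)
          \<and> \<rho> N k Z lam = Max ((\<lambda>\<mu>. cmod ((of_real lam - \<mu>) / (of_real lam + \<mu>)))
                              ` spectrum (complex_mat (HT N k Z))))
      \<and> (\<exists>lam>0. \<rho> N k Z lam = rate N k)
      \<and> (\<forall>lam>0. rate N k \<le> \<rho> N k Z lam)"
    if pos: "\<forall>l<d. N l > 0" and k: "k > 0" and Z: "tangent_basis (num_nodes d N) (\<lambda>i. m) Z" for N k Z
  proof -
    interpret fourier_grid d L K N by (rule grid[OF pos])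
    have c: "\<theta> * k * C > 0" using \<theta> k assms(3) by simp
    note p = assms(2) c assms(6) Z
    show ?thesis
      using tangent_grid_facts[OF p] spectral_radius_T[OF p] ex_optimal_shift[OF p] rate_le[OF pos k Z]
      unfolding rate_def \<rho>_def T_def HT_def ST_def by blast
  qed
  have family: "((\<lambda>i. rate (N i) (k i)) \<longlongrightarrow> 1) F
      \<and> (F \<noteq> bot \<longrightarrow>
          (\<forall>Z lam. (\<forall>i. tangent_basis (num_nodes d (N i)) (\<lambda>_. m) (Z i) \<and> lam i > 0) \<longrightarrow>
             \<not> (\<exists>q<1. \<forall>\<^sub>F i in F. \<rho> (N i) (k i) (Z i) (lam i) \<le> q)))"
    if pos: "\<forall>i. (\<forall>l<d. N i l > 0) \<and> k i > 0"
      and h: "((\<lambda>i. mesh_width d L (N i)) \<longlongrightarrow> 0) F"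
      and kh: "filterlim (\<lambda>i. k i / (mesh_width d L (N i))\<^sup>2) at_top F"
    for F :: "'i filter" and N k
  proof (intro conjI impI allI notI)
    show lim: "((\<lambda>i. rate (N i) (k i)) \<longlongrightarrow> 1) F"
      unfolding rate_def
      by (rule rate_tendsto_1_family[OF assms(5,7) _ _ d assms(2) _ h kh]) (use pos \<theta> assms(3) in auto)
    fix Z lam
    assume F: "F \<noteq> bot" and Z: "\<forall>i. tangent_basis (num_nodes d (N i)) (\<lambda>_. m) (Z i) \<and> lam i > 0"
      and "\<exists>q<1. \<forall>\<^sub>F i in F. \<rho> (N i) (k i) (Z i) (lam i) \<le> q"
    then obtain q where q: "q < 1" "\<forall>\<^sub>F i in F. \<rho> (N i) (k i) (Z i) (lam i) \<le> q" by blast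
    \<comment> \<open>The lower bound holds for every basis and shift, so a uniform q would also
      bound the rates, whose limit is 1.\<close>
    have le: "rate (N i) (k i) \<le> \<rho> (N i) (k i) (Z i) (lam i)" for i
      using pos Z by (intro rate_le) auto
    have "\<forall>\<^sub>F i in F. rate (N i) (k i) \<le> q"
      using q(2) by eventually_elim (rule order_trans[OF le])
    from tendsto_upperbound[OF lim this F] q(1) show False by simp
  qed
  show ?thesis
    by (rule conjI[OF _ conjI]; intro allI impI; (elim conjE)?; rule basis fixed family; assumption)
qed

end
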